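(* Let $n\geq 2$ be a natural number and $R$ an $n$-bounded ceer. Then there is an $\lfloor n/2\rfloor$-bounded ceer $S$ such that $R\leq S'$. Equivalently, $B^n_\infty\leq (B^{\lfloor n/2\rfloor}_\infty)'$.
   Context: A ceer is an equivalence relation on $\mathbb N$ c.e. as a subset of $\mathbb N^2$; $R_1\leq R_2$ means there is a total computable $f$ with $xR_1y\Leftrightarrow f(x)R_2f(y)$. A ceer is $k$-bounded ($k>0$) if each class has at most $k$ elements. Let $\varphi_e$ be the standard enumeration of partial computable functions, $W_e$ the c.e. sets, $\langle\cdot,\cdot\rangle$ a computable pairing. The halting jump of a ceer $E$ is $xE'y\Leftrightarrow x=y\lor(\varphi_x(x)\!\downarrow,\varphi_y(y)\!\downarrow,\ \varphi_x(x)E\varphi_y(y))$. For $k\geq1$, $B^k_e$ is obtained from the enumeration of the equivalence relation generated by $\{(x,y):\langle x,y\rangle\in W_e\}$ by omitting any pair that would create a class of size $>k$, and $\langle x,z\rangle B^k_\infty\langle y,z\rangle\Leftrightarrow xB^k_zy$ (no other distinct pairs related); $B^k_\infty$ is universal among $k$-bounded ceers. *)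

theory Defs
  imports Main "HOL-Library.Nat_Bijection"
begin

text \<open>
  The partial computable functions are Kleene's partial recursive functions, presented as unary
  functions; several arguments are passed through the Cantor pairing
  \<^term>\<open>prod_encode :: nat \<times> nat \<Rightarrow> nat\<close>.
\<close>

type_synonym pfun = "nat \<Rightarrow> nat option"

definition pf_pair :: "pfun \<Rightarrow> pfun \<Rightarrow> pfun" where
  "pf_pair f g x = Option.bind (f x) (\<lambda>a. Option.bind (g x) (\<lambda>b. Some (prod_encode (a, b))))"

definition pf_comp :: "pfun \<Rightarrow> pfun \<Rightarrow> pfun" where
  "pf_comp f g x = Option.bind (g x) f"

text \<open>Primitive recursion: \<open>h \<langle>a, 0\<rangle> = f a\<close> and \<open>h \<langle>a, k + 1\<rangle> = g \<langle>a, \<langle>k, h \<langle>a, k\<rangle>\<rangle>\<rangle>\<close>.\<close>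

definition pf_prec :: "pfun \<Rightarrow> pfun \<Rightarrow> pfun" where
  "pf_prec f g x = (case prod_decode x of (a, m) \<Rightarrow>
     rec_nat (f a)
       (\<lambda>k r. Option.bind r (\<lambda>v. g (prod_encode (a, prod_encode (k, v))))) m)"

definition mu_witness :: "pfun \<Rightarrow> nat \<Rightarrow> nat \<Rightarrow> bool" where
  "mu_witness f x m \<longleftrightarrow> f (prod_encode (x, m)) = Some 0 \<and>
     (\<forall>k<m. \<exists>v. f (prod_encode (x, k)) = Some (Suc v))"

definition pf_mu :: "pfun \<Rightarrow> pfun" where
  "pf_mu f x = (if \<exists>m. mu_witness f x m then Some (THE m. mu_witness f x m) else None)"

datatype prog = Zero | Succ | First | Second
  | PairP prog prog | CompP prog prog | PrecP prog prog | MuP prog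

primrec eval :: "prog \<Rightarrow> pfun" where
  "eval Zero = (\<lambda>x. Some 0)"
| "eval Succ = (\<lambda>x. Some (Suc x))"
| "eval First = (\<lambda>x. Some (fst (prod_decode x)))"
| "eval Second = (\<lambda>x. Some (snd (prod_decode x)))"
| "eval (PairP p q) = pf_pair (eval p) (eval q)"
| "eval (CompP p q) = pf_comp (eval p) (eval q)"
| "eval (PrecP p q) = pf_prec (eval p) (eval q)"
| "eval (MuP p) = pf_mu (eval p)"

text \<open>
  Goedel numbering: every natural number is the index of exactly one program
  (\<open>bij_decode_prog\<close> below).
\<close>

fun encode_prog :: "prog \<Rightarrow> nat" where
  "encode_prog Zero = 0"
| "encode_prog Succ = 1"
| "encode_prog First = 2"
| "encode_prog Second = 3"
| "encode_prog (PairP p q) = 4 + 4 * prod_encode (encode_prog p, encode_prog q)"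
| "encode_prog (CompP p q) = 5 + 4 * prod_encode (encode_prog p, encode_prog q)"
| "encode_prog (PrecP p q) = 6 + 4 * prod_encode (encode_prog p, encode_prog q)"
| "encode_prog (MuP p) = 7 + 4 * encode_prog p"

lemma fst_prod_decode_le: "fst (prod_decode n) \<le> n"
  by (metis le_prod_encode_1 prod.collapse prod_decode_inverse)

lemma snd_prod_decode_le: "snd (prod_decode n) \<le> n"
  by (metis le_prod_encode_2 prod.collapse prod_decode_inverse)

lemma decode_arg_less:
  assumes "\<not> (n::nat) < 4"
  shows "fst (prod_decode ((n - 4) div 4)) < n" "snd (prod_decode ((n - 4) div 4)) < n"
    "(n - 4) div 4 < n"
proof -
  show *: "(n - 4) div 4 < n" using assms by linarith
  show "fst (prod_decode ((n - 4) div 4)) < n" "snd (prod_decode ((n - 4) div 4)) < n"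
    using * fst_prod_decode_le snd_prod_decode_le le_less_trans by blast+
qed

function decode_prog :: "nat \<Rightarrow> prog" where
  "decode_prog n =
    (if n = 0 then Zero else if n = 1 then Succ else if n = 2 then First else if n = 3 then Second
     else
       let m = (n - 4) div 4; i = fst (prod_decode m); j = snd (prod_decode m); r = n mod 4 in
       if r = 0 then PairP (decode_prog i) (decode_prog j)
       else if r = 1 then CompP (decode_prog i) (decode_prog j)
       else if r = 2 then PrecP (decode_prog i) (decode_prog j)
       else MuP (decode_prog m))"
  by pat_completeness auto
termination
  by (relation "measure id") (auto simp: decode_arg_less)

declare decode_prog.simps [simp del]

lemma decode_encode_prog: "decode_prog (encode_prog p) = p"
proof (induction p)
  case (PairP p q)
  then show ?case by (subst decode_prog.simps) (simp add: mod_mult_self2)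
next
  case (CompP p q)
  have "(5 + 4 * k) mod 4 = 1" "Suc (4 * k) div 4 = k" for k :: nat by presburger+
  with CompP show ?case by (subst decode_prog.simps) (simp add: Let_def)
next
  case (PrecP p q)
  have "(6 + 4 * k) mod 4 = 2" "Suc (Suc (4 * k)) div 4 = k" "(2 + 4 * k) div 4 = k" for k :: nat
    by presburger+
  with PrecP show ?case by (subst decode_prog.simps) (simp add: Let_def)
next
  case (MuP p)
  have "(7 + 4 * k) mod 4 = 3" "(3 + 4 * k) div 4 = k" for k :: nat by presburger+
  with MuP show ?case by (subst decode_prog.simps) (simp add: Let_def)
qed (simp_all add: decode_prog.simps)

lemma encode_decode_prog: "encode_prog (decode_prog n) = n"
proof (induction n rule: less_induct)
  case (less n)
  define m where "m = (n - 4) div 4"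
  show ?case
  proof (cases "n < 4")
    case True
    then have "n = 0 \<or> n = 1 \<or> n = 2 \<or> n = 3" by linarith
    then show ?thesis by (auto simp: decode_prog.simps)
  next
    case False
    note IH = less[OF decode_arg_less(1)[OF False]] less[OF decode_arg_less(2)[OF False]]
      less[OF decode_arg_less(3)[OF False]]
    have n: "n = 4 + 4 * m + n mod 4" using False unfolding m_def by presburger
    have r: "n mod 4 = 0 \<or> n mod 4 = 1 \<or> n mod 4 = 2 \<or> n mod 4 = 3" by presburger
    have "encode_prog (decode_prog n) = 4 + 4 * m + n mod 4"
      using r IH False
      by (subst decode_prog.simps) (auto simp: Let_def m_def[symmetric])
    then show ?thesis using n by simp
  qed
qed

lemma bij_decode_prog: "bij decode_prog"
  by (rule bij_betw_byWitness[where f' = encode_prog])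
     (auto simp: decode_encode_prog encode_decode_prog)

definition phi :: "nat \<Rightarrow> pfun" where
  "phi e = eval (decode_prog e)"

definition W :: "nat \<Rightarrow> nat set" where
  "W e = dom (phi e)"

definition computable :: "(nat \<Rightarrow> nat) \<Rightarrow> bool" where
  "computable f \<longleftrightarrow> (\<exists>e. \<forall>x. phi e x = Some (f x))"

text \<open>
  Stage \<open>t\<close> of the evaluation runs the program with all inputs and outputs of all subprograms,
  and hence all searches, bounded by \<open>t\<close>. This is total, and \<open>eval_at_iff\<close> and
  \<open>eval_at_mono\<close> below show that it approximates \<^const>\<open>eval\<close> from below and exhausts it.
\<close>

definition cut :: "nat \<Rightarrow> pfun \<Rightarrow> pfun" where
  "cut t f x = (if x \<le> t then Option.bind (f x) (\<lambda>y. if y \<le> t then Some y else None) else None)"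

primrec eval_at :: "nat \<Rightarrow> prog \<Rightarrow> pfun" where
  "eval_at t Zero = cut t (\<lambda>x. Some 0)"
| "eval_at t Succ = cut t (\<lambda>x. Some (Suc x))"
| "eval_at t First = cut t (\<lambda>x. Some (fst (prod_decode x)))"
| "eval_at t Second = cut t (\<lambda>x. Some (snd (prod_decode x)))"
| "eval_at t (PairP p q) = cut t (pf_pair (eval_at t p) (eval_at t q))"
| "eval_at t (CompP p q) = cut t (pf_comp (eval_at t p) (eval_at t q))"
| "eval_at t (PrecP p q) = cut t (pf_prec (eval_at t p) (eval_at t q))"
| "eval_at t (MuP p) = cut t (pf_mu (eval_at t p))"

definition W_at :: "nat \<Rightarrow> nat \<Rightarrow> nat set" where
  "W_at e t = dom (eval_at t (decode_prog e))"

lemma cut_eq_Some: "cut t f x = Some y \<longleftrightarrow> x \<le> t \<and> y \<le> t \<and> f x = Some y"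
  by (auto simp: cut_def bind_eq_Some_conv)

lemma mu_witness_unique: "mu_witness f x m \<Longrightarrow> mu_witness f x m' \<Longrightarrow> m = m'"
  unfolding mu_witness_def
  by (metis Zero_not_Suc linorder_neqE_nat option.inject)

lemma pf_mu_eq_Some: "pf_mu f x = Some m \<longleftrightarrow> mu_witness f x m"
proof -
  have "(THE m. mu_witness f x m) = k" if "mu_witness f x k" for k
    using that mu_witness_unique by (intro the_equality) blast+
  then show ?thesis by (auto simp: pf_mu_def)
qed

lemma pf_prec_0: "pf_prec f g (prod_encode (a, 0)) = f a"
  by (simp add: pf_prec_def)

lemma pf_prec_Suc:
  "pf_prec f g (prod_encode (a, Suc k)) =
     Option.bind (pf_prec f g (prod_encode (a, k))) (\<lambda>v. g (prod_encode (a, prod_encode (k, v))))"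
  by (simp add: pf_prec_def)

definition pf_le :: "pfun \<Rightarrow> pfun \<Rightarrow> bool" where
  "pf_le f g \<longleftrightarrow> (\<forall>x y. f x = Some y \<longrightarrow> g x = Some y)"

lemma pf_pair_mono: "pf_le f f' \<Longrightarrow> pf_le g g' \<Longrightarrow> pf_le (pf_pair f g) (pf_pair f' g')"
  by (auto simp: pf_le_def pf_pair_def bind_eq_Some_conv)

lemma pf_comp_mono: "pf_le f f' \<Longrightarrow> pf_le g g' \<Longrightarrow> pf_le (pf_comp f g) (pf_comp f' g')"
  by (fastforce simp: pf_le_def pf_comp_def bind_eq_Some_conv)

lemma pf_prec_mono:
  assumes "pf_le f f'" "pf_le g g'"
  shows "pf_le (pf_prec f g) (pf_prec f' g')"
proof -
  have "pf_prec f g (prod_encode (a, m)) = Some y \<Longrightarrow>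
      pf_prec f' g' (prod_encode (a, m)) = Some y" for a m y
  proof (induction m arbitrary: y)
    case 0
    then show ?case using assms(1) by (simp add: pf_prec_0 pf_le_def)
  next
    case (Suc m)
    then show ?case using assms(2) by (fastforce simp: pf_prec_Suc pf_le_def bind_eq_Some_conv)
  qed
  then show ?thesis unfolding pf_le_def by (metis prod.collapse prod_decode_inverse)
qed

lemma pf_mu_mono: "pf_le f f' \<Longrightarrow> pf_le (pf_mu f) (pf_mu f')"
  by (fastforce simp: pf_le_def pf_mu_eq_Some mu_witness_def)

lemma cut_mono: "t \<le> t' \<Longrightarrow> pf_le f f' \<Longrightarrow> pf_le (cut t f) (cut t' f')"
  by (auto simp: pf_le_def cut_eq_Some)

lemma pf_le_cut: "pf_le f f' \<Longrightarrow> pf_le (cut t f) f'"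
  by (auto simp: pf_le_def cut_eq_Some)

lemma pf_le_refl: "pf_le f f"
  by (simp add: pf_le_def)

lemma eval_at_mono_le: "t \<le> t' \<Longrightarrow> pf_le (eval_at t p) (eval_at t' p)"
  by (induction p)
     (simp_all add: cut_mono pf_le_refl pf_pair_mono pf_comp_mono pf_prec_mono pf_mu_mono)

lemma eval_at_le_eval: "pf_le (eval_at t p) (eval p)"
  by (induction p)
     (simp_all add: pf_le_cut pf_le_refl pf_pair_mono pf_comp_mono pf_prec_mono pf_mu_mono)

lemma eval_at_mono: "eval_at t p x = Some y \<Longrightarrow> t \<le> t' \<Longrightarrow> eval_at t' p x = Some y"
  using eval_at_mono_le unfolding pf_le_def by blast

definition approximates :: "(nat \<Rightarrow> pfun) \<Rightarrow> pfun \<Rightarrow> bool" where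
  "approximates F f \<longleftrightarrow> (\<forall>x y. f x = Some y \<longrightarrow> (\<forall>\<^sub>F t in sequentially. F t x = Some y))"

lemma approximates_cut:
  assumes "approximates F f"
  shows "approximates (\<lambda>t. cut t (F t)) f"
  unfolding approximates_def
proof (intro allI impI)
  fix x y assume "f x = Some y"
  then have "\<forall>\<^sub>F t in sequentially. F t x = Some y" using assms by (simp add: approximates_def)
  then show "\<forall>\<^sub>F t in sequentially. cut t (F t) x = Some y"
    using eventually_ge_at_top[of x] eventually_ge_at_top[of y]
    by eventually_elim (simp add: cut_eq_Some)
qed

lemma approximates_pair:
  assumes "approximates F f" "approximates G g"
  shows "approximates (\<lambda>t. pf_pair (F t) (G t)) (pf_pair f g)"
  unfolding approximates_def
proof (intro allI impI)
  fix x y assume "pf_pair f g x = Some y"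
  then obtain a b where ab: "f x = Some a" "g x = Some b" "y = prod_encode (a, b)"
    by (auto simp: pf_pair_def bind_eq_Some_conv)
  then have "\<forall>\<^sub>F t in sequentially. F t x = Some a" "\<forall>\<^sub>F t in sequentially. G t x = Some b"
    using assms by (auto simp: approximates_def)
  then show "\<forall>\<^sub>F t in sequentially. pf_pair (F t) (G t) x = Some y"
    by eventually_elim (simp add: pf_pair_def ab)
qed

lemma approximates_comp:
  assumes "approximates F f" "approximates G g"
  shows "approximates (\<lambda>t. pf_comp (F t) (G t)) (pf_comp f g)"
  unfolding approximates_def
proof (intro allI impI)
  fix x y assume "pf_comp f g x = Some y"
  then obtain b where b: "g x = Some b" "f b = Some y"
    by (auto simp: pf_comp_def bind_eq_Some_conv)
  then have "\<forall>\<^sub>F t in sequentially. G t x = Some b" "\<forall>\<^sub>F t in sequentially. F t b = Some y"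
    using assms by (auto simp: approximates_def)
  then show "\<forall>\<^sub>F t in sequentially. pf_comp (F t) (G t) x = Some y"
    by eventually_elim (simp add: pf_comp_def)
qed

lemma approximates_prec:
  assumes "approximates F f" "approximates G g"
  shows "approximates (\<lambda>t. pf_prec (F t) (G t)) (pf_prec f g)"
proof -
  have "pf_prec f g (prod_encode (a, m)) = Some y \<Longrightarrow>
      \<forall>\<^sub>F t in sequentially. pf_prec (F t) (G t) (prod_encode (a, m)) = Some y" for a m y
  proof (induction m arbitrary: y)
    case 0
    then show ?case using assms(1) by (simp add: pf_prec_0 approximates_def)
  next
    case (Suc m)
    then obtain v where v: "pf_prec f g (prod_encode (a, m)) = Some v"
      "g (prod_encode (a, prod_encode (m, v))) = Some y"
      by (auto simp: pf_prec_Suc bind_eq_Some_conv)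
    then have "\<forall>\<^sub>F t in sequentially. G t (prod_encode (a, prod_encode (m, v))) = Some y"
      using assms(2) by (simp add: approximates_def)
    with Suc.IH[OF v(1)] show ?case
      by eventually_elim (simp add: pf_prec_Suc)
  qed
  then show ?thesis unfolding approximates_def by (metis prod.collapse prod_decode_inverse)
qed

lemma approximates_mu:
  assumes "approximates F f"
  shows "approximates (\<lambda>t. pf_mu (F t)) (pf_mu f)"
  unfolding approximates_def
proof (intro allI impI)
  fix x m assume "pf_mu f x = Some m"
  then have m: "f (prod_encode (x, m)) = Some 0"
    and "\<forall>k<m. \<exists>v. f (prod_encode (x, k)) = Some (Suc v)"
    by (auto simp: pf_mu_eq_Some mu_witness_def)
  then obtain v where v: "\<forall>k<m. f (prod_encode (x, k)) = Some (Suc (v k))" by metis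
  have "\<forall>\<^sub>F t in sequentially. F t (prod_encode (x, m)) = Some 0"
    using assms m by (simp add: approximates_def)
  moreover have "\<forall>\<^sub>F t in sequentially. \<forall>k\<in>{..<m}. F t (prod_encode (x, k)) = Some (Suc (v k))"
    using assms v by (intro eventually_ball_finite) (auto simp: approximates_def)
  ultimately show "\<forall>\<^sub>F t in sequentially. pf_mu (F t) x = Some m"
    by eventually_elim (auto simp: pf_mu_eq_Some mu_witness_def)
qed

lemma approximates_const: "approximates (\<lambda>t. f) f"
  by (simp add: approximates_def)

lemma approximates_eval_at: "approximates (\<lambda>t. eval_at t p) (eval p)"
  by (induction p)
     (simp_all add: approximates_cut approximates_const approximates_pair approximates_comp
        approximates_prec approximates_mu)

lemma eval_at_iff: "eval p x = Some y \<longleftrightarrow> (\<exists>t. eval_at t p x = Some y)"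
proof
  assume "eval p x = Some y"
  then have "\<forall>\<^sub>F t in sequentially. eval_at t p x = Some y"
    using approximates_eval_at by (simp add: approximates_def)
  then show "\<exists>t. eval_at t p x = Some y" by (auto simp: eventually_sequentially)
next
  show "\<exists>t. eval_at t p x = Some y \<Longrightarrow> eval p x = Some y"
    using eval_at_le_eval by (auto simp: pf_le_def)
qed

lemma W_eq_Union_W_at: "W e = (\<Union>t. W_at e t)"
  by (auto simp: W_def W_at_def phi_def dom_def eval_at_iff)

definition ce_rel :: "(nat \<times> nat) set \<Rightarrow> bool" where
  "ce_rel R \<longleftrightarrow> (\<exists>e. prod_encode ` R = W e)"

definition ceer :: "(nat \<times> nat) set \<Rightarrow> bool" where
  "ceer R \<longleftrightarrow> equiv UNIV R \<and> ce_rel R"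

definition reducible :: "(nat \<times> nat) set \<Rightarrow> (nat \<times> nat) set \<Rightarrow> bool" (infix "\<le>\<^sub>c" 50) where
  "R1 \<le>\<^sub>c R2 \<longleftrightarrow> (\<exists>f. computable f \<and> (\<forall>x y. (x, y) \<in> R1 \<longleftrightarrow> (f x, f y) \<in> R2))"

definition bounded_classes :: "nat \<Rightarrow> (nat \<times> nat) set \<Rightarrow> bool" where
  "bounded_classes k R \<longleftrightarrow> (\<forall>C \<in> UNIV // R. finite C \<and> card C \<le> k)"

definition bounded_ceer :: "nat \<Rightarrow> (nat \<times> nat) set \<Rightarrow> bool" where
  "bounded_ceer k R \<longleftrightarrow> 0 < k \<and> ceer R \<and> bounded_classes k R"

definition halting_jump :: "(nat \<times> nat) set \<Rightarrow> (nat \<times> nat) set" where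
  "halting_jump E = {(x, y). x = y \<or>
     (\<exists>a b. phi x x = Some a \<and> phi y y = Some b \<and> (a, b) \<in> E)}"

definition generated_equiv :: "(nat \<times> nat) set \<Rightarrow> (nat \<times> nat) set" where
  "generated_equiv A = (A \<union> A\<inverse>)\<^sup>*"

text \<open>
  The equivalence relation generated by the pairs coded in \<open>W e\<close> is enumerated in stages:
  stage \<open>s = \<langle>\<langle>x, y\<rangle>, t\<rangle>\<close> enumerates \<open>(x, y)\<close> if this pair belongs to the equivalence relation
  generated by the finite set \<open>W_at e t\<close>. Hence every pair of the generated relation is enumerated.
  An enumerated pair is added, and the result closed under equivalence, unless this
  creates a class with more than \<open>k\<close> elements.
\<close>

definition add_pair :: "nat \<Rightarrow> nat \<times> nat \<Rightarrow> (nat \<times> nat) set \<Rightarrow> (nat \<times> nat) set" where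
  "add_pair k p B =
     (let B' = generated_equiv (insert p B) in if bounded_classes k B' then B' else B)"

primrec B_stage :: "nat \<Rightarrow> nat \<Rightarrow> nat \<Rightarrow> (nat \<times> nat) set" where
  "B_stage k e 0 = Id"
| "B_stage k e (Suc s) =
     (let (c, t) = prod_decode s; p = prod_decode c in
      if p \<in> generated_equiv (prod_decode ` W_at e t) then add_pair k p (B_stage k e s)
      else B_stage k e s)"

definition B :: "nat \<Rightarrow> nat \<Rightarrow> (nat \<times> nat) set" where
  "B k e = (\<Union>s. B_stage k e s)"

text \<open>Reflexive because every \<open>B k z\<close> is and every number is a pair.\<close>

definition B_inf :: "nat \<Rightarrow> (nat \<times> nat) set" where
  "B_inf k = {(prod_encode (x, z), prod_encode (y, z)) | x y z. (x, y) \<in> B k z}"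

end

theory Submission
  imports Defs
begin

text \<open>
  Given an \<open>n\<close>-bounded ceer \<open>R\<close>, map \<open>x\<close> injectively to an index of a program that waits until \<open>x\<close>
  is seen to be equivalent to another element and then outputs an element \<open>a\<close> of its class. The
  images of elements of trivial classes then diverge and are singletons of the jump. The outputs
  come from a c.e. set that contains at most half of each nontrivial class, and restricting \<open>R\<close>
  to this set gives \<open>S\<close>. Composing the outputs with a reduction of \<open>S\<close> to \<open>T\<close> reduces \<open>R\<close> to
  the jump of \<open>T\<close>. For the second claim, \<open>R\<close> is \<open>B_inf n\<close> and \<open>T\<close> is \<open>B_inf (n div 2)\<close>, which is
  universal; that \<open>B_inf n\<close> is c.e. requires a decision procedure for the stages of the universal
  enumeration.
\<close>

subsection \<open>Closure properties of computable functions and decidable predicates\<close>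

lemma computable_iff_eval: "computable f \<longleftrightarrow> (\<exists>p. \<forall>x. eval p x = Some (f x))"
  unfolding computable_def phi_def by (metis decode_encode_prog)

definition decidable :: "(nat \<Rightarrow> bool) \<Rightarrow> bool" where
  "decidable P \<longleftrightarrow> computable (\<lambda>x. of_bool (P x))"

named_theorems computable_intros

lemma computable_id [computable_intros]: "computable (\<lambda>x. x)"
proof -
  have "eval (CompP First (PairP First Zero)) x = Some (fst (prod_decode x))"
    "eval (PairP First Second) x = Some x" for x
    by (simp_all add: pf_comp_def pf_pair_def)
  then show ?thesis unfolding computable_iff_eval by blast
qed

lemma computable_comp: "computable f \<Longrightarrow> computable g \<Longrightarrow> computable (\<lambda>x. f (g x))"
proof -
  assume "computable f" "computable g"
  then obtain p q where "\<And>x. eval p x = Some (f x)" "\<And>x. eval q x = Some (g x)"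
    unfolding computable_iff_eval by blast
  then have "eval (CompP p q) x = Some (f (g x))" for x by (simp add: pf_comp_def)
  then show ?thesis unfolding computable_iff_eval by blast
qed

lemma computable_fst [computable_intros]:
  assumes "computable f"
  shows "computable (\<lambda>x. fst (prod_decode (f x)))"
proof -
  have "eval First x = Some (fst (prod_decode x))" for x by simp
  then have "computable (\<lambda>x. fst (prod_decode x))" unfolding computable_iff_eval by blast
  from computable_comp[OF this assms] show ?thesis .
qed

lemma computable_snd [computable_intros]:
  assumes "computable f"
  shows "computable (\<lambda>x. snd (prod_decode (f x)))"
proof -
  have "eval Second x = Some (snd (prod_decode x))" for x by simp
  then have "computable (\<lambda>x. snd (prod_decode x))" unfolding computable_iff_eval by blast
  from computable_comp[OF this assms] show ?thesis .
qed

lemma computable_Suc [computable_intros]: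
  assumes "computable f"
  shows "computable (\<lambda>x. Suc (f x))"
proof -
  have "eval Succ x = Some (Suc x)" for x by simp
  then have "computable (\<lambda>x. Suc x)" unfolding computable_iff_eval by blast
  from computable_comp[OF this assms] show ?thesis .
qed

primrec const_prog :: "nat \<Rightarrow> prog" where
  "const_prog 0 = Zero"
| "const_prog (Suc n) = CompP Succ (const_prog n)"

lemma eval_const_prog [simp]: "eval (const_prog n) x = Some n"
  by (induction n) (simp_all add: pf_comp_def)

lemma computable_const [computable_intros]: "computable (\<lambda>x. c)"
  unfolding computable_iff_eval using eval_const_prog by blast

lemma computable_pair [computable_intros]:
  assumes "computable f" "computable g"
  shows "computable (\<lambda>x. prod_encode (f x, g x))"
proof -
  obtain p q where "\<And>x. eval p x = Some (f x)" "\<And>x. eval q x = Some (g x)"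
    using assms unfolding computable_iff_eval by blast
  then have "eval (PairP p q) x = Some (prod_encode (f x, g x))" for x by (simp add: pf_pair_def)
  then show ?thesis unfolding computable_iff_eval by blast
qed

text \<open>The step function takes parameter, counter and previous value as one nested pair, the
  argument shape of \<open>PrecP\<close>. Feeding \<open>PrecP\<close> the pair of \<open>x\<close>
  and \<open>m x\<close> lets the recursion depth depend on \<open>x\<close>.\<close>

lemma computable_rec_nat:
  assumes "computable f"
    and "computable (\<lambda>z. g (fst (prod_decode z)) (fst (prod_decode (snd (prod_decode z))))
      (snd (prod_decode (snd (prod_decode z)))))"
    and "computable m"
  shows "computable (\<lambda>x. rec_nat (f x) (\<lambda>k r. g x k r) (m x))"
proof -
  obtain p where p: "\<And>x. eval p x = Some (f x)"
    using assms(1) unfolding computable_iff_eval by blast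
  obtain q where q: "\<And>x k r. eval q (prod_encode (x, prod_encode (k, r))) = Some (g x k r)"
    using assms(2) unfolding computable_iff_eval
    by (metis fst_conv prod_encode_inverse snd_conv)
  have "eval (PrecP p q) (prod_encode (x, n)) = Some (rec_nat (f x) (\<lambda>k r. g x k r) n)" for x n
    by (induction n) (simp_all add: pf_prec_0 pf_prec_Suc p q)
  then have "computable (\<lambda>z. rec_nat (f (fst (prod_decode z)))
      (\<lambda>k r. g (fst (prod_decode z)) k r) (snd (prod_decode z)))"
    unfolding computable_iff_eval by (metis prod.collapse prod_decode_inverse)
  from computable_comp[OF this computable_pair[OF computable_id assms(3)]] show ?thesis by simp
qed

lemma computable_pred: "computable f \<Longrightarrow> computable (\<lambda>x. f x - 1)"
proof -
  assume "computable f"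
  then have "computable (\<lambda>x. rec_nat 0 (\<lambda>k r. k) (f x))"
    by (intro computable_rec_nat computable_intros)
  moreover have "rec_nat 0 (\<lambda>k r. k) n = n - 1" for n :: nat by (cases n) auto
  ultimately show ?thesis by simp
qed

lemma computable_add [computable_intros]:
  assumes "computable f" "computable g"
  shows "computable (\<lambda>x. f x + g x)"
proof -
  have "rec_nat a (\<lambda>k r. Suc r) b = a + b" for a b :: nat by (induction b) auto
  moreover have "computable (\<lambda>x. rec_nat (f x) (\<lambda>k r. Suc r) (g x))"
    using assms by (intro computable_rec_nat computable_intros)
  ultimately show ?thesis by simp
qed

lemma computable_diff [computable_intros]:
  assumes "computable f" "computable g"
  shows "computable (\<lambda>x. f x - g x)"
proof -
  have "rec_nat a (\<lambda>k r. r - 1) b = a - b" for a b :: nat by (induction b) auto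
  moreover have "computable (\<lambda>x. rec_nat (f x) (\<lambda>k r. r - 1) (g x))"
    using assms by (intro computable_rec_nat computable_pred computable_intros)
  ultimately show ?thesis by simp
qed

lemma computable_mult [computable_intros]:
  assumes "computable f" "computable g"
  shows "computable (\<lambda>x. f x * g x)"
proof -
  have "rec_nat 0 (\<lambda>k r. r + a) b = a * b" for a b :: nat by (induction b) auto
  moreover have "computable (\<lambda>x. rec_nat 0 (\<lambda>k r. r + f x) (g x))"
    using assms(2) by (intro computable_rec_nat computable_comp[OF assms(1)] computable_intros)
  ultimately show ?thesis by simp
qed

lemma computable_power [computable_intros]:
  assumes "computable f" "computable g"
  shows "computable (\<lambda>x. f x ^ g x)"
proof -
  have "rec_nat 1 (\<lambda>k r. r * a) b = a ^ b" for a b :: nat by (induction b) auto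
  moreover have "computable (\<lambda>x. rec_nat 1 (\<lambda>k r. r * f x) (g x))"
    using assms(2) by (intro computable_rec_nat computable_comp[OF assms(1)] computable_intros)
  ultimately show ?thesis by simp
qed

section \<open>Decidable predicates and bounded quantifiers\<close>

lemma decidable_comp: "decidable P \<Longrightarrow> computable f \<Longrightarrow> decidable (\<lambda>x. P (f x))"
  unfolding decidable_def by (rule computable_comp)

lemma decidable_le [computable_intros]:
  assumes "computable f" "computable g"
  shows "decidable (\<lambda>x. f x \<le> g x)"
proof -
  have "computable (\<lambda>x. 1 - (f x - g x))" using assms by (intro computable_intros)
  moreover have "1 - (a - b) = of_bool (a \<le> b)" for a b :: nat by simp
  ultimately show ?thesis by (simp only: decidable_def)
qed

lemma decidable_less [computable_intros]:
  assumes "computable f" "computable g"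
  shows "decidable (\<lambda>x. f x < g x)"
  using decidable_le[OF computable_Suc[OF assms(1)] assms(2)] by (simp only: Suc_le_eq)

lemma decidable_not [computable_intros]:
  assumes "decidable P"
  shows "decidable (\<lambda>x. \<not> P x)"
proof -
  have "computable (\<lambda>x. 1 - of_bool (P x))"
    using assms unfolding decidable_def by (intro computable_intros)
  moreover have "1 - of_bool b = (of_bool (\<not> b) :: nat)" for b by simp
  ultimately show ?thesis by (simp only: decidable_def)
qed

lemma decidable_conj [computable_intros]:
  assumes "decidable P" "decidable Q"
  shows "decidable (\<lambda>x. P x \<and> Q x)"
proof -
  have "computable (\<lambda>x. of_bool (P x) * of_bool (Q x))"
    using assms unfolding decidable_def by (intro computable_intros)
  then show ?thesis by (simp only: decidable_def of_bool_conj)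
qed

lemma decidable_disj [computable_intros]:
  assumes "decidable P" "decidable Q"
  shows "decidable (\<lambda>x. P x \<or> Q x)"
proof -
  have "decidable (\<lambda>x. \<not> (\<not> P x \<and> \<not> Q x))"
    using assms by (intro computable_intros)
  then show ?thesis by simp
qed

lemma decidable_imp [computable_intros]:
  assumes "decidable P" "decidable Q"
  shows "decidable (\<lambda>x. P x \<longrightarrow> Q x)"
  using decidable_disj[OF decidable_not[OF assms(1)] assms(2)] by (simp only: imp_conv_disj)

lemma decidable_iff [computable_intros]:
  assumes "decidable P" "decidable Q"
  shows "decidable (\<lambda>x. P x \<longleftrightarrow> Q x)"
  using decidable_conj[OF decidable_imp[OF assms] decidable_imp[OF assms(2,1)]]
  by (simp only: iff_conv_conj_imp)

lemma decidable_eq [computable_intros]: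
  assumes "computable f" "computable g"
  shows "decidable (\<lambda>x. f x = g x)"
  using decidable_conj[OF decidable_le[OF assms] decidable_le[OF assms(2,1)]]
  by (simp only: order_eq_iff[symmetric])

lemma decidable_if [computable_intros]:
  assumes "decidable P" "decidable Q" "decidable R"
  shows "decidable (\<lambda>x. if P x then Q x else R x)"
  unfolding if_bool_eq_conj using assms by (intro computable_intros)

text \<open>Truth values are added up by recursion. Both bounded quantifiers reduce to this count,
  and so does the size of a class later on.\<close>

lemma computable_card_less [computable_intros]:
  assumes "decidable (\<lambda>z. P (fst (prod_decode z)) (snd (prod_decode z)))" "computable b"
  shows "computable (\<lambda>x. card {k. k < b x \<and> P x k})"
proof -
  have card: "rec_nat 0 (\<lambda>k r. r + of_bool (Q k)) n = card {k. k < n \<and> Q k}"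
    for n :: nat and Q
  proof (induction n)
    case (Suc n)
    have "{k. k < Suc n \<and> Q k} = (if Q n then insert n {k. k < n \<and> Q k} else {k. k < n \<and> Q k})"
      by (auto simp: less_Suc_eq)
    with Suc show ?case by simp
  qed simp
  have "computable (\<lambda>z. of_bool (P (fst (prod_decode z)) (fst (prod_decode (snd (prod_decode z))))))"
    using computable_comp[OF assms(1)[unfolded decidable_def], of "\<lambda>z. prod_encode
      (fst (prod_decode z), fst (prod_decode (snd (prod_decode z))))"]
    by (simp add: computable_intros)
  then have "computable (\<lambda>x. rec_nat 0 (\<lambda>k r. r + of_bool (P x k)) (b x))"
    using assms(2) by (intro computable_rec_nat computable_intros)
  then show ?thesis by (simp only: card)
qed

lemma decidable_bex_less [computable_intros]:
  assumes "decidable (\<lambda>z. P (fst (prod_decode z)) (snd (prod_decode z)))" "computable b"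
  shows "decidable (\<lambda>x. \<exists>k<b x. P x k)"
proof -
  have "(\<exists>k<b x. P x k) \<longleftrightarrow> 0 < card {k. k < b x \<and> P x k}" for x
    by (auto simp: card_gt_0_iff)
  then show ?thesis using assms by (simp only:) (intro computable_intros)
qed

lemma decidable_ball_less [computable_intros]:
  assumes "decidable (\<lambda>z. P (fst (prod_decode z)) (snd (prod_decode z)))" "computable b"
  shows "decidable (\<lambda>x. \<forall>k<b x. P x k)"
proof -
  have "decidable (\<lambda>x. \<not> (\<exists>k<b x. \<not> P x k))" using assms by (intro computable_intros)
  then show ?thesis by simp
qed

lemma decidable_bex_le [computable_intros]:
  assumes "decidable (\<lambda>z. P (fst (prod_decode z)) (snd (prod_decode z)))" "computable b"
  shows "decidable (\<lambda>x. \<exists>k\<le>b x. P x k)"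
  using decidable_bex_less[OF assms(1) computable_Suc[OF assms(2)]] by (simp only: less_Suc_eq_le)

lemma decidable_ball_le [computable_intros]:
  assumes "decidable (\<lambda>z. P (fst (prod_decode z)) (snd (prod_decode z)))" "computable b"
  shows "decidable (\<lambda>x. \<forall>k\<le>b x. P x k)"
  using decidable_ball_less[OF assms(1) computable_Suc[OF assms(2)]] by (simp only: less_Suc_eq_le)

section \<open>Unbounded search\<close>

text \<open>\<open>MuP\<close> stops at the value 0, so it runs on the characteristic function of
  the negation. Divergence in the absence of a witness is part of the statement because c.e. sets
  and the computations in the jump rely on it.\<close>

lemma computable_Least_partial:
  assumes "decidable (\<lambda>z. P (fst (prod_decode z)) (snd (prod_decode z)))"
  obtains p where "\<And>x. eval p x = (if \<exists>k. P x k then Some (LEAST k. P x k) else None)"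
proof -
  obtain q where q: "\<And>x k. eval q (prod_encode (x, k)) = Some (of_bool (\<not> P x k))"
    using decidable_not[OF assms] unfolding decidable_def computable_iff_eval
    by (metis fst_conv prod_encode_inverse snd_conv)
  have w: "mu_witness (eval q) x m \<longleftrightarrow> P x m \<and> (\<forall>k<m. \<not> P x k)" for x m
    by (auto simp: mu_witness_def q)
  have "eval (MuP q) x = (if \<exists>k. P x k then Some (LEAST k. P x k) else None)" for x
  proof (cases "\<exists>k. P x k")
    case True
    then have "mu_witness (eval q) x (LEAST k. P x k)"
      unfolding w by (metis LeastI_ex not_less_Least)
    with True show ?thesis by (simp add: pf_mu_eq_Some)
  next
    case False
    then show ?thesis by (auto simp: pf_mu_def w)
  qed
  then show ?thesis using that by blast
qed

lemma computable_Least: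
  assumes "decidable (\<lambda>z. P (fst (prod_decode z)) (snd (prod_decode z)))" "\<And>x. \<exists>k. P x k"
  shows "computable (\<lambda>x. LEAST k. P x k)"
  using computable_Least_partial[OF assms(1)] assms(2) unfolding computable_iff_eval by metis

lemma computable_div [computable_intros]:
  assumes "computable f" "computable g"
  shows "computable (\<lambda>x. f x div g x)"
proof -
  \<comment> \<open>The quotient as a search. The disjunct \<open>n = 0\<close> ends it at once with
    0, the value of division by zero.\<close>
  have *: "m div n = (LEAST q. n = 0 \<or> m < n * Suc q)" for m n :: nat
  proof (cases "n = 0")
    case False
    show ?thesis
    proof (rule Least_equality[symmetric])
      show "n = 0 \<or> m < n * Suc (m div n)"
        using False dividend_less_times_div by auto
      show "m div n \<le> q" if "n = 0 \<or> m < n * Suc q" for q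
        using that False less_mult_imp_div_less[of m "Suc q" n] by (simp add: mult.commute)
    qed
  qed simp
  show ?thesis unfolding *
  proof (rule computable_Least)
    show "\<exists>q. g x = 0 \<or> f x < g x * Suc q" for x
      by (intro exI[of _ "f x"]) (cases "g x", auto)
    show "decidable (\<lambda>z. g (fst (prod_decode z)) = 0 \<or>
        f (fst (prod_decode z)) < g (fst (prod_decode z)) * Suc (snd (prod_decode z)))"
      by (intro computable_intros computable_comp[OF assms(1)] computable_comp[OF assms(2)])
  qed
qed

lemma computable_mod [computable_intros]:
  assumes "computable f" "computable g"
  shows "computable (\<lambda>x. f x mod g x)"
  unfolding minus_div_mult_eq_mod[symmetric] using assms by (intro computable_intros)

lemma decidable_mem_set_decode [computable_intros]:
  assumes "computable f" "computable g"
  shows "decidable (\<lambda>x. f x \<in> set_decode (g x))"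
proof -
  have "decidable (\<lambda>x. g x div 2 ^ f x mod 2 = 1)" using assms by (intro computable_intros)
  then show ?thesis by (simp add: set_decode_def odd_iff_mod_2_eq_one)
qed

text \<open>
  To decide \<open>P x\<close>, search for the first certificate \<open>T\<close> and read the answer off from it. The
  certificates used below are finite tables, coded by \<^const>\<open>set_decode\<close>, that contain all
  values of a recursively defined predicate up to some bound and are recognized by their
  recursion equations.
\<close>

lemma decidable_certificate:
  assumes "decidable (\<lambda>z. C (fst (prod_decode z)) (snd (prod_decode z)))"
    and "decidable (\<lambda>z. Q (fst (prod_decode z)) (snd (prod_decode z)))"
    and "\<And>x. \<exists>T. C x T" and "\<And>x T. C x T \<Longrightarrow> Q x T \<longleftrightarrow> P x"
  shows "decidable P"
proof -
  have "computable (\<lambda>x. prod_encode (x, LEAST T. C x T))"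
    by (intro computable_intros computable_Least assms(1,3))
  from decidable_comp[OF assms(2) this] have "decidable (\<lambda>x. Q x (LEAST T. C x T))" by simp
  moreover have "Q x (LEAST T. C x T) \<longleftrightarrow> P x" for x
    using assms(4) LeastI_ex[OF assms(3)] by blast
  ultimately show ?thesis by simp
qed

subsection \<open>Deciding the stages of the evaluation\<close>

text \<open>The recursion equations of \<open>eval_at\<close>, with \<open>M\<close> standing for
  the graph of the evaluation at stage \<open>t\<close> and programs replaced by their numbers.
  Intermediate values are at most \<open>t\<close> because of \<open>cut\<close>, so every
  quantifier is bounded.\<close>

definition eval_step :: "nat \<Rightarrow> (nat \<Rightarrow> nat \<Rightarrow> nat \<Rightarrow> bool) \<Rightarrow> nat \<Rightarrow> nat \<Rightarrow> nat \<Rightarrow> bool" where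
  "eval_step t M e x y \<longleftrightarrow>
    (if e = 0 then y = 0 else if e = 1 then y = Suc x
     else if e = 2 then y = fst (prod_decode x) else if e = 3 then y = snd (prod_decode x)
     else if e mod 4 = 0 then
       M (fst (prod_decode ((e - 4) div 4))) x (fst (prod_decode y)) \<and>
       M (snd (prod_decode ((e - 4) div 4))) x (snd (prod_decode y))
     else if e mod 4 = 1 then
       (\<exists>v\<le>t. M (snd (prod_decode ((e - 4) div 4))) x v \<and>
         M (fst (prod_decode ((e - 4) div 4))) v y)
     else if e mod 4 = 2 then
       (if snd (prod_decode x) = 0
        then M (fst (prod_decode ((e - 4) div 4))) (fst (prod_decode x)) y
        else \<exists>v\<le>t. M e (prod_encode (fst (prod_decode x), snd (prod_decode x) - 1)) v \<and>
          M (snd (prod_decode ((e - 4) div 4)))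
            (prod_encode (fst (prod_decode x), prod_encode (snd (prod_decode x) - 1, v))) y)
     else M ((e - 4) div 4) (prod_encode (x, y)) 0 \<and>
       (\<forall>k<y. \<exists>v\<le>t. M ((e - 4) div 4) (prod_encode (x, k)) (Suc v)))"

lemma eval_at_bounds: "eval_at t p x = Some y \<Longrightarrow> x \<le> t \<and> y \<le> t"
  by (cases p) (auto simp: cut_eq_Some)

lemma eval_at_pair: "eval_at t (PairP p q) x = Some y \<longleftrightarrow> x \<le> t \<and> y \<le> t \<and>
    eval_at t p x = Some (fst (prod_decode y)) \<and> eval_at t q x = Some (snd (prod_decode y))"
  by (auto simp: cut_eq_Some pf_pair_def bind_eq_Some_conv)

lemma eval_at_comp: "eval_at t (CompP p q) x = Some y \<longleftrightarrow> x \<le> t \<and> y \<le> t \<and>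
    (\<exists>v\<le>t. eval_at t q x = Some v \<and> eval_at t p v = Some y)"
  using eval_at_bounds[of t q] by (auto simp: cut_eq_Some pf_comp_def bind_eq_Some_conv)

text \<open>The recursive call is itself subject to \<open>cut\<close>. This loses nothing: its
  input code is smaller than \<open>x\<close>, and its value is an output of a subprogram, hence at
  most \<open>t\<close>.\<close>

lemma eval_at_prec: "eval_at t (PrecP p q) x = Some y \<longleftrightarrow> x \<le> t \<and> y \<le> t \<and>
   (if snd (prod_decode x) = 0 then eval_at t p (fst (prod_decode x)) = Some y
    else \<exists>v\<le>t. eval_at t (PrecP p q)
        (prod_encode (fst (prod_decode x), snd (prod_decode x) - 1)) = Some v \<and>
      eval_at t q (prod_encode (fst (prod_decode x), prod_encode (snd (prod_decode x) - 1, v)))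
        = Some y)"
proof -
  obtain a m where x: "x = prod_encode (a, m)" by (metis prod.collapse prod_decode_inverse)
  show ?thesis
  proof (cases m)
    case 0
    then show ?thesis by (simp add: x cut_eq_Some pf_prec_0)
  next
    case (Suc k)
    have le: "v \<le> t" if "pf_prec (eval_at t p) (eval_at t q) (prod_encode (a, k)) = Some v" for v
      using that eval_at_bounds
      by (cases k) (fastforce simp: pf_prec_0 pf_prec_Suc bind_eq_Some_conv)+
    have "prod_encode (a, k) \<le> t" if "x \<le> t"
      using that by (simp add: x Suc prod_encode_def)
    then show ?thesis using le by (auto simp: x Suc cut_eq_Some pf_prec_Suc bind_eq_Some_conv)
  qed
qed

lemma eval_at_mu: "eval_at t (MuP p) x = Some y \<longleftrightarrow> x \<le> t \<and> y \<le> t \<and>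
    eval_at t p (prod_encode (x, y)) = Some 0 \<and>
    (\<forall>k<y. \<exists>v\<le>t. eval_at t p (prod_encode (x, k)) = Some (Suc v))"
  using eval_at_bounds[of t p] by (fastforce simp: cut_eq_Some pf_mu_eq_Some mu_witness_def)

lemma eval_at_step: "eval_at t (decode_prog e) x = Some y \<longleftrightarrow>
    x \<le> t \<and> y \<le> t \<and> eval_step t (\<lambda>e x y. eval_at t (decode_prog e) x = Some y) e x y"
proof -
  have "e mod 4 = 0 \<or> e mod 4 = 1 \<or> e mod 4 = 2 \<or> e mod 4 = 3" by presburger
  then consider "e < 4" | "4 \<le> e" "e mod 4 = 0" | "4 \<le> e" "e mod 4 = 1" | "4 \<le> e" "e mod 4 = 2"
    | "4 \<le> e" "e mod 4 = 3" by linarith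
  then show ?thesis
  proof cases
    case 1
    then have "e = 0 \<or> e = 1 \<or> e = 2 \<or> e = 3" by linarith
    then show ?thesis
      by (auto simp: eval_step_def decode_prog.simps[of e] cut_eq_Some)
  next
    case 2
    then have "decode_prog e = PairP (decode_prog (fst (prod_decode ((e - 4) div 4))))
        (decode_prog (snd (prod_decode ((e - 4) div 4))))"
      by (subst decode_prog.simps) (simp add: Let_def)
    with 2 show ?thesis by (simp add: eval_step_def eval_at_pair del: eval_at.simps)
  next
    case 3
    then have "decode_prog e = CompP (decode_prog (fst (prod_decode ((e - 4) div 4))))
        (decode_prog (snd (prod_decode ((e - 4) div 4))))"
      by (subst decode_prog.simps) (simp add: Let_def)
    with 3 show ?thesis by (simp add: eval_step_def eval_at_comp del: eval_at.simps)
  next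
    case 4
    then have *: "decode_prog e = PrecP (decode_prog (fst (prod_decode ((e - 4) div 4))))
        (decode_prog (snd (prod_decode ((e - 4) div 4))))"
      by (subst decode_prog.simps) (simp add: Let_def)
    show ?thesis
      using 4 unfolding eval_step_def by (simp only: *, subst eval_at_prec) simp
  next
    case 5
    then have "decode_prog e = MuP (decode_prog ((e - 4) div 4))"
      by (subst decode_prog.simps) (simp add: Let_def)
    with 5 show ?thesis by (simp add: eval_step_def eval_at_mu del: eval_at.simps)
  qed
qed

text \<open>A step consults only smaller program numbers, or the same number at a smaller input
  (primitive recursion at the preceding counter). This well-foundedness makes the solution of the
  equations unique.\<close>

lemma eval_step_cong:
  assumes "\<And>i u v. i < e \<Longrightarrow> M i u v = N i u v" "\<And>u v. u < x \<Longrightarrow> M e u v = N e u v"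
  shows "eval_step t M e x y = eval_step t N e x y"
proof (cases "e < 4")
  case True
  then have "e = 0 \<or> e = 1 \<or> e = 2 \<or> e = 3" by linarith
  then show ?thesis by (auto simp: eval_step_def)
next
  case False
  have "prod_encode (fst (prod_decode x), snd (prod_decode x) - 1) < x" if "snd (prod_decode x) \<noteq> 0"
  proof -
    have "prod_encode (a, m - 1) < prod_encode (a, m)" if "m \<noteq> 0" for a m
      using that by (cases m) (simp_all add: prod_encode_def)
    then have "prod_encode (fst (prod_decode x), snd (prod_decode x) - 1) <
        prod_encode (fst (prod_decode x), snd (prod_decode x))" using that by blast
    then show ?thesis by simp
  qed
  then show ?thesis
    using assms(1)[OF decode_arg_less(1)[OF False]] assms(1)[OF decode_arg_less(2)[OF False]]
      assms(1)[OF decode_arg_less(3)[OF False]] assms(2)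
    unfolding eval_step_def by simp
qed

text \<open>Outer induction on the program number and inner induction on the input, with
  \<open>eval_step_cong\<close> comparing the two right-hand sides.\<close>

lemma eval_step_unique:
  assumes M: "\<And>i x y. i \<le> e \<Longrightarrow> M i x y \<longleftrightarrow> x \<le> t \<and> y \<le> t \<and> eval_step t M i x y"
  shows "M e x y \<longleftrightarrow> eval_at t (decode_prog e) x = Some y"
proof -
  let ?N = "\<lambda>e x y. eval_at t (decode_prog e) x = Some y"
  have "\<forall>y. M i x y = ?N i x y" if "i \<le> e" for i x
    using that
  proof (induction i arbitrary: x rule: less_induct)
    case (less i)
    note outer = less
    show ?case
    proof (induction x rule: less_induct)
      case (less x)
      have "eval_step t M i x y = eval_step t ?N i x y" for y
        using outer less by (intro eval_step_cong) auto
      then show ?case using M[OF outer(2)] eval_at_step by blast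
    qed
  qed
  then show ?thesis by blast
qed

lemma finite_set_code: "finite A \<Longrightarrow> \<exists>T. set_decode T = A"
  using set_encode_inverse by blast

text \<open>The explicit bounds make entries beyond \<open>t\<close> false whatever \<open>T\<close>
  contains, so checking the equations up to \<open>t\<close> suffices for
  \<open>eval_step_unique\<close>.\<close>

definition eval_table :: "nat \<Rightarrow> nat \<Rightarrow> nat \<Rightarrow> nat \<Rightarrow> nat \<Rightarrow> bool" where
  "eval_table t T e x y \<longleftrightarrow>
     x \<le> t \<and> y \<le> t \<and> prod_encode (e, prod_encode (x, y)) \<in> set_decode T"

lemma eval_table_exists:
  "\<exists>T. \<forall>i\<le>e. \<forall>x\<le>t. \<forall>y\<le>t. eval_table t T i x y \<longleftrightarrow> eval_step t (eval_table t T) i x y"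
proof -
  \<comment> \<open>The true graph serves as the table. It is finite, since inputs and outputs are
    at most \<open>t\<close> and program numbers at most \<open>e\<close>.\<close>
  let ?P = "\<lambda>i x y. i \<le> e \<and> eval_at t (decode_prog i) x = Some y"
  let ?A = "{prod_encode (i, prod_encode (x, y)) | i x y. ?P i x y}"
  have "?A \<subseteq> (\<lambda>(i, x, y). prod_encode (i, prod_encode (x, y))) ` ({..e} \<times> {..t} \<times> {..t})"
  proof safe
    fix i x y assume "i \<le> e" "eval_at t (decode_prog i) x = Some y"
    then have "(i, x, y) \<in> {..e} \<times> {..t} \<times> {..t}" by (auto dest: eval_at_bounds)
    from imageI[OF this, of "\<lambda>(i, x, y). prod_encode (i, prod_encode (x, y))"]
    show "prod_encode (i, prod_encode (x, y)) \<in>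
        (\<lambda>(i, x, y). prod_encode (i, prod_encode (x, y))) ` ({..e} \<times> {..t} \<times> {..t})"
      by (simp only: prod.case)
  qed
  then have fin: "finite ?A" by (rule finite_subset) simp
  obtain T where T: "set_decode T = ?A" using finite_set_code[OF fin] by blast
  have "prod_encode (i, prod_encode (x, y)) \<in> set_decode T \<longleftrightarrow> ?P i x y" for i x y
    unfolding T by simp
  then have eq: "eval_table t T i x y \<longleftrightarrow> eval_at t (decode_prog i) x = Some y" if "i \<le> e" for i x y
    using that eval_at_bounds by (auto simp: eval_table_def)
  have "eval_step t (eval_table t T) i x y \<longleftrightarrow>
      eval_step t (\<lambda>i x y. eval_at t (decode_prog i) x = Some y) i x y" if "i \<le> e" for i x y
    using that eq by (intro eval_step_cong) simp_all
  then have "eval_table t T i x y \<longleftrightarrow> eval_step t (eval_table t T) i x y"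
    if "i \<le> e" "x \<le> t" "y \<le> t" for i x y
    using that eval_at_step[of t i x y] eq[of i x y] by blast
  then show ?thesis by blast
qed

lemma decidable_eval_at [computable_intros]:
  assumes "computable t" "computable e" "computable x" "computable y"
  shows "decidable (\<lambda>z. eval_at (t z) (decode_prog (e z)) (x z) = Some (y z))"
proof -
  \<comment> \<open>The certificate is a table satisfying the equations for all program numbers up
    to \<open>e\<close>; the answer is its entry at the requested arguments.\<close>
  let ?C = "\<lambda>t e T. \<forall>i\<le>e. \<forall>x\<le>t. \<forall>y\<le>t.
    eval_table t T i x y \<longleftrightarrow> eval_step t (eval_table t T) i x y"
  let ?t = "\<lambda>z. fst (prod_decode z)" and ?e = "\<lambda>z. fst (prod_decode (snd (prod_decode z)))"
  let ?x = "\<lambda>z. fst (prod_decode (snd (prod_decode (snd (prod_decode z)))))"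
  let ?y = "\<lambda>z. snd (prod_decode (snd (prod_decode (snd (prod_decode z)))))"
  have "decidable (\<lambda>z. eval_at (?t z) (decode_prog (?e z)) (?x z) = Some (?y z))"
  proof (rule decidable_certificate)
    show "decidable (\<lambda>z. (\<lambda>z T. ?C (?t z) (?e z) T) (fst (prod_decode z)) (snd (prod_decode z)))"
      unfolding eval_table_def eval_step_def by (intro computable_intros)
    show "decidable (\<lambda>z. (\<lambda>z T. eval_table (?t z) T (?e z) (?x z) (?y z))
        (fst (prod_decode z)) (snd (prod_decode z)))"
      unfolding eval_table_def by (intro computable_intros)
    show "\<exists>T. ?C (?t z) (?e z) T" for z by (rule eval_table_exists)
    show "eval_table (?t z) T (?e z) (?x z) (?y z) \<longleftrightarrow>
        eval_at (?t z) (decode_prog (?e z)) (?x z) = Some (?y z)" if "?C (?t z) (?e z) T" for z T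
    proof (rule eval_step_unique)
      have "eval_table (?t z) T i x y \<Longrightarrow> x \<le> ?t z \<and> y \<le> ?t z" for i x y
        by (simp add: eval_table_def)
      then show "eval_table (?t z) T i x y \<longleftrightarrow>
          x \<le> ?t z \<and> y \<le> ?t z \<and> eval_step (?t z) (eval_table (?t z) T) i x y"
        if "i \<le> ?e z" for i x y
        using that \<open>?C (?t z) (?e z) T\<close> by blast
    qed
  qed
  from decidable_comp[OF this, of "\<lambda>z. prod_encode (t z, prod_encode (e z, prod_encode (x z, y z)))"]
  show ?thesis using assms by (simp add: computable_intros)
qed

lemma decidable_mem_W_at [computable_intros]:
  assumes "computable c" "computable e" "computable t"
  shows "decidable (\<lambda>z. c z \<in> W_at (e z) (t z))"
proof -
  have "c \<in> W_at e t \<longleftrightarrow> (\<exists>y\<le>t. eval_at t (decode_prog e) c = Some y)" for c e t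
    using eval_at_bounds by (auto simp: W_at_def)
  then show ?thesis
    by (simp only:) (intro computable_intros assms computable_comp[OF assms(1)]
      computable_comp[OF assms(2)] computable_comp[OF assms(3)])
qed

subsection \<open>Deciding the stages of the bounded enumeration\<close>

lemma generated_equiv_mem: "(x, y) \<in> A \<Longrightarrow> (x, y) \<in> generated_equiv A"
  unfolding generated_equiv_def by auto

lemma equiv_generated_equiv: "equiv UNIV (generated_equiv A)"
  unfolding generated_equiv_def
  by (intro equivI refl_rtrancl sym_rtrancl trans_rtrancl) (auto simp: sym_def)

lemma generated_equiv_least:
  assumes "equiv UNIV E" "A \<subseteq> E"
  shows "generated_equiv A \<subseteq> E"
proof -
  have "sym E" "refl E" "trans E" using assms(1) by (simp_all add: equiv_def)
  then have "A \<union> A\<inverse> \<subseteq> E" using assms(2) unfolding sym_def by blast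
  then have "generated_equiv A \<subseteq> E\<^sup>*" unfolding generated_equiv_def by (rule rtrancl_mono)
  also have "E\<^sup>* = E"
    using \<open>refl E\<close> \<open>trans E\<close> by (auto simp: rtrancl_trancl_reflcl trancl_id dest: refl_onD)
  finally show ?thesis .
qed

lemma bounded_classes_iff:
  "bounded_classes k R \<longleftrightarrow> (\<forall>x. finite (R `` {x}) \<and> card (R `` {x}) \<le> k)"
  unfolding bounded_classes_def quotient_def by auto

lemma bounded_classes_subset: "bounded_classes k R \<Longrightarrow> S \<subseteq> R \<Longrightarrow> bounded_classes k S"
  unfolding bounded_classes_iff
  by (meson Image_mono card_mono finite_subset le_trans subset_refl)

text \<open>When \<open>M\<close> is an equivalence relation, this merges the classes of
  \<open>a\<close> and \<open>b\<close>; unlike a transitive closure it needs no quantifier.\<close>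

definition join :: "nat \<Rightarrow> nat \<Rightarrow> (nat \<Rightarrow> nat \<Rightarrow> bool) \<Rightarrow> nat \<Rightarrow> nat \<Rightarrow> bool" where
  "join a b M x y \<longleftrightarrow> M x y \<or> M x a \<and> M b y \<or> M x b \<and> M a y"

text \<open>The join is an equivalence relation containing \<open>E\<close> and the new pair, so it
  contains the generated one. Conversely, each of its disjuncts is a chain using the new pair at
  most once.\<close>

lemma generated_equiv_insert:
  assumes "equiv UNIV E"
  shows "(x, y) \<in> generated_equiv (insert (a, b) E) \<longleftrightarrow> join a b (\<lambda>x y. (x, y) \<in> E) x y"
proof
  let ?J = "{(x, y). join a b (\<lambda>x y. (x, y) \<in> E) x y}"
  have r: "(u, u) \<in> E" and s: "(u, v) \<in> E \<Longrightarrow> (v, u) \<in> E"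
    and t: "(u, v) \<in> E \<Longrightarrow> (v, w) \<in> E \<Longrightarrow> (u, w) \<in> E" for u v w
    using assms by (auto elim!: equivE dest: refl_onD symD transD)
  have "equiv UNIV ?J"
  proof (intro equivI)
    show "refl ?J" using r by (auto simp: refl_on_def join_def)
    show "sym ?J" unfolding sym_def join_def using s by blast
    show "trans ?J" unfolding trans_def join_def mem_Collect_eq split_conv using s t by metis
  qed simp
  moreover have "insert (a, b) E \<subseteq> ?J" using r by (auto simp: join_def)
  ultimately have "generated_equiv (insert (a, b) E) \<subseteq> ?J" by (rule generated_equiv_least)
  then show "(x, y) \<in> generated_equiv (insert (a, b) E) \<Longrightarrow> join a b (\<lambda>x y. (x, y) \<in> E) x y"
    by blast
next
  let ?G = "generated_equiv (insert (a, b) E)"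
  have g: "(u, v) \<in> E \<Longrightarrow> (u, v) \<in> ?G" "(a, b) \<in> ?G" for u v
    by (simp_all add: generated_equiv_mem)
  have s: "(u, v) \<in> ?G \<Longrightarrow> (v, u) \<in> ?G"
    and t: "(u, v) \<in> ?G \<Longrightarrow> (v, w) \<in> ?G \<Longrightarrow> (u, w) \<in> ?G" for u v w
    using equiv_generated_equiv[of "insert (a, b) E"] by (auto elim!: equivE dest: symD transD)
  show "join a b (\<lambda>x y. (x, y) \<in> E) x y \<Longrightarrow> (x, y) \<in> ?G"
    unfolding join_def
    by (elim disjE conjE) (use g(1) t[OF g(1) t[OF g(2) g(1)]] t[OF g(1) t[OF s[OF g(2)] g(1)]] in blast)+
qed

text \<open>Only the merged class, that of \<open>a\<close>, can be too large, so one cardinality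
  replaces the test over all classes.\<close>

lemma bounded_classes_generated_insert:
  assumes E: "equiv UNIV E" and "bounded_classes k E"
  shows "bounded_classes k (generated_equiv (insert (a, b) E)) \<longleftrightarrow>
    card {y. join a b (\<lambda>x y. (x, y) \<in> E) a y} \<le> k"
proof -
  let ?G = "generated_equiv (insert (a, b) E)"
  have G: "equiv UNIV ?G" by (rule equiv_generated_equiv)
  have a: "?G `` {a} = {y. join a b (\<lambda>x y. (x, y) \<in> E) a y}"
    using generated_equiv_insert[OF E] by auto
  have "?G `` {a} \<subseteq> E `` {a} \<union> E `` {b}"
    unfolding a join_def by auto
  moreover have "finite (E `` {a} \<union> E `` {b})" using assms(2) by (simp add: bounded_classes_iff)
  ultimately have fin: "finite (?G `` {a})" by (rule finite_subset)
  \<comment> \<open>An element outside the merged class was related to neither \<open>a\<close> nor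
    \<open>b\<close>, so its class is unchanged.\<close>
  have "?G `` {x} = ?G `` {a} \<or> ?G `` {x} = E `` {x}" for x
  proof (cases "(x, a) \<in> ?G")
    case True
    then show ?thesis using equiv_class_eq[OF G] by blast
  next
    case False
    moreover have "(a, a) \<in> E" "(b, b) \<in> E" using E by (auto elim!: equivE dest: refl_onD)
    ultimately have "(x, a) \<notin> E" "(x, b) \<notin> E"
      unfolding generated_equiv_insert[OF E] join_def by blast+
    then have "(x, y) \<in> ?G \<longleftrightarrow> (x, y) \<in> E" for y
      unfolding generated_equiv_insert[OF E] join_def by blast
    then show ?thesis by blast
  qed
  then have "bounded_classes k ?G \<longleftrightarrow> card (?G `` {a}) \<le> k"
    using fin assms(2) unfolding bounded_classes_iff by metis
  then show ?thesis unfolding a .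
qed

section \<open>Recursion equations for the stages\<close>

lemma equiv_B_stage: "equiv UNIV (B_stage k e s)"
proof (induction s)
  case 0
  show ?case by (simp add: equiv_def refl_Id sym_Id trans_Id)
qed (simp add: add_pair_def Let_def equiv_generated_equiv split: prod.split)

lemma bounded_B_stage: "0 < k \<Longrightarrow> bounded_classes k (B_stage k e s)"
  by (induction s)
     (auto simp: add_pair_def Let_def bounded_classes_iff split: prod.split)

lemma B_stage_Suc_mono: "B_stage k e s \<subseteq> B_stage k e (Suc s)"
  by (auto simp: add_pair_def Let_def intro!: generated_equiv_mem split: prod.split)

lemma B_stage_mono: "s \<le> s' \<Longrightarrow> B_stage k e s \<subseteq> B_stage k e s'"
  using B_stage_Suc_mono by (rule lift_Suc_mono_le)

lemma B_stage_Suc: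
  fixes s :: nat
  defines "c \<equiv> fst (prod_decode s)" and "t \<equiv> snd (prod_decode s)"
  defines "a \<equiv> fst (prod_decode c)" and "b \<equiv> snd (prod_decode c)"
  assumes "0 < k"
  shows "(x, y) \<in> B_stage k e (Suc s) \<longleftrightarrow>
    (if prod_decode c \<in> generated_equiv (prod_decode ` W_at e t) \<and>
        card {v. join a b (\<lambda>x y. (x, y) \<in> B_stage k e s) a v} \<le> k
     then join a b (\<lambda>x y. (x, y) \<in> B_stage k e s) x y else (x, y) \<in> B_stage k e s)"
proof -
  have c: "prod_decode s = (c, t)" "prod_decode c = (a, b)" by (simp_all add: c_def t_def a_def b_def)
  show ?thesis
    using bounded_classes_generated_insert[OF equiv_B_stage bounded_B_stage[OF assms(5)], of a b]
      generated_equiv_insert[OF equiv_B_stage, of x y a b]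
    by (simp add: c Let_def add_pair_def)
qed

text \<open>A Cantor code bounds its components, so the pair handled on passing from a stage to the
  next has entries at most the stage number. Hence numbers from \<open>s\<close> on are still alone
  in their classes, and the size of a class is a bounded count.\<close>

lemma B_stage_bounds: "0 < k \<Longrightarrow> (x, y) \<in> B_stage k e s \<Longrightarrow> x = y \<or> x < s \<and> y < s"
proof (induction s arbitrary: x y)
  case (Suc s)
  let ?c = "fst (prod_decode s)"
  have "fst (prod_decode ?c) \<le> s" "snd (prod_decode ?c) \<le> s"
    using fst_prod_decode_le[of s] fst_prod_decode_le[of ?c] snd_prod_decode_le[of ?c] by linarith+
  with Suc show ?case
    unfolding B_stage_Suc[OF Suc.prems(1)] join_def
    by (fastforce split: if_splits dest: Suc.IH)
qed simp

text \<open>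
  Reachability in a finite graph as a bounded quantification, over the codes \<open>U\<close> of vertex sets
  closed under edges.
\<close>

lemma generated_equiv_W_at_iff:
  "prod_decode c \<in> generated_equiv (prod_decode ` W_at e t) \<longleftrightarrow>
   (\<forall>U < 2 ^ Suc (t + c). fst (prod_decode c) \<in> set_decode U \<and>
      (\<forall>d\<le>t. d \<in> W_at e t \<longrightarrow>
         (fst (prod_decode d) \<in> set_decode U \<longleftrightarrow> snd (prod_decode d) \<in> set_decode U)) \<longrightarrow>
      snd (prod_decode c) \<in> set_decode U)"
  (is "_ \<in> ?G \<longleftrightarrow> ?R")
proof
  obtain x y where c: "prod_decode c = (x, y)" by fastforce
  have W: "d \<le> t" if "d \<in> W_at e t" for d
    using that eval_at_bounds by (auto simp: W_at_def)
  {
    assume "prod_decode c \<in> ?G"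
    then have G: "(x, y) \<in> (prod_decode ` W_at e t \<union> (prod_decode ` W_at e t)\<inverse>)\<^sup>*"
      by (simp add: c generated_equiv_def)
    show ?R
    proof (intro allI impI, elim conjE)
      fix U assume "fst (prod_decode c) \<in> set_decode U" and closed: "\<forall>d\<le>t. d \<in> W_at e t \<longrightarrow>
        (fst (prod_decode d) \<in> set_decode U \<longleftrightarrow> snd (prod_decode d) \<in> set_decode U)"
      then have x: "x \<in> set_decode U" by (simp add: c)
      have "fst p \<in> set_decode U \<longleftrightarrow> snd p \<in> set_decode U"
        if "p \<in> prod_decode ` W_at e t" for p
        using that closed W by auto
      then have "v \<in> set_decode U"
        if "u \<in> set_decode U" "(u, v) \<in> prod_decode ` W_at e t \<union> (prod_decode ` W_at e t)\<inverse>" for u v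
        using that by fastforce
      with G x have "y \<in> set_decode U" by (induction rule: rtrancl_induct) blast+
      then show "snd (prod_decode c) \<in> set_decode U" by (simp add: c)
    qed
  next
    assume R: ?R
    \<comment> \<open>The component of \<open>x\<close>, cut off at \<open>t + c\<close>. No end of
      an edge of \<open>W_at e t\<close> exceeds the cutoff, and neither do \<open>x\<close> and
      \<open>y\<close>, so the truncated set is still closed under edges.\<close>
    let ?V = "{v. v \<le> t + c \<and> (x, v) \<in> ?G}"
    have "set_encode ?V \<le> (\<Sum>i\<in>{0..<Suc (t + c)}. 2 ^ i)"
      unfolding set_encode_def by (rule sum_mono2) auto
    also have "\<dots> < 2 ^ Suc (t + c)" by (simp only: sum_power2) simp
    finally have V: "set_encode ?V < 2 ^ Suc (t + c)" "set_decode (set_encode ?V) = ?V" by simp_all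
    have xy: "x \<le> t + c" "y \<le> t + c"
      using fst_prod_decode_le[of c] snd_prod_decode_le[of c] by (simp_all add: c)
    have G: "equiv UNIV ?G" by (rule equiv_generated_equiv)
    have "(x, fst (prod_decode d)) \<in> ?G \<longleftrightarrow> (x, snd (prod_decode d)) \<in> ?G"
      if "d \<in> W_at e t" for d
    proof -
      have "(fst (prod_decode d), snd (prod_decode d)) \<in> ?G"
        using that by (intro generated_equiv_mem) auto
      with G show ?thesis by (meson equivE symD transD)
    qed
    moreover have "fst (prod_decode d) \<le> t + c" "snd (prod_decode d) \<le> t + c" if "d \<le> t" for d
      using fst_prod_decode_le[of d] snd_prod_decode_le[of d] that by linarith+
    moreover have "(x, x) \<in> ?G" using G by (meson UNIV_I equivE refl_onD)
    ultimately have "snd (prod_decode c) \<in> ?V"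
      using R[rule_format, OF V(1)] xy by (simp add: V(2) c)
    then show "prod_decode c \<in> ?G" by (simp add: c)
  }
qed

lemma decidable_generated_equiv_W_at [computable_intros]:
  assumes "computable c" "computable e" "computable t"
  shows "decidable (\<lambda>z. prod_decode (c z) \<in> generated_equiv (prod_decode ` W_at (e z) (t z)))"
  unfolding generated_equiv_W_at_iff
  by (intro computable_intros assms computable_comp[OF assms(1)] computable_comp[OF assms(2)]
      computable_comp[OF assms(3)])

text \<open>The counterpart of \<open>eval_step\<close> for the stages. The bound
  \<open>Suc N\<close> on \<open>v\<close> turns the cardinality into a bounded count; by
  \<open>B_stage_bounds\<close> it cuts off nothing from the true stages as long as \<open>s\<close>
  is at most \<open>N\<close>.\<close>

definition B_step ::
    "nat \<Rightarrow> nat \<Rightarrow> nat \<Rightarrow> (nat \<Rightarrow> nat \<Rightarrow> nat \<Rightarrow> bool) \<Rightarrow> nat \<Rightarrow> nat \<Rightarrow> nat \<Rightarrow> bool" where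
  "B_step k e N M s x y \<longleftrightarrow> (if s = 0 then x = y else
     if prod_decode (fst (prod_decode (s - 1))) \<in>
          generated_equiv (prod_decode ` W_at e (snd (prod_decode (s - 1)))) \<and>
        card {v. v < Suc N \<and> join (fst (prod_decode (fst (prod_decode (s - 1)))))
          (snd (prod_decode (fst (prod_decode (s - 1))))) (M (s - 1))
          (fst (prod_decode (fst (prod_decode (s - 1))))) v} \<le> k
     then join (fst (prod_decode (fst (prod_decode (s - 1)))))
       (snd (prod_decode (fst (prod_decode (s - 1))))) (M (s - 1)) x y
     else M (s - 1) x y)"

lemma B_stage_step:
  assumes "0 < k" "s \<le> N"
  shows "(x, y) \<in> B_stage k e s \<longleftrightarrow> B_step k e N (\<lambda>s x y. (x, y) \<in> B_stage k e s) s x y"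
proof (cases s)
  case (Suc r)
  let ?c = "fst (prod_decode r)"
  let ?J = "join (fst (prod_decode ?c)) (snd (prod_decode ?c)) (\<lambda>x y. (x, y) \<in> B_stage k e r)"
  have *: "fst (prod_decode ?c) \<le> r" "snd (prod_decode ?c) \<le> r"
    using fst_prod_decode_le[of r] fst_prod_decode_le[of ?c] snd_prod_decode_le[of ?c] by linarith+
  have "v < Suc N" if "?J (fst (prod_decode ?c)) v" for v
    using that * assms(2) Suc unfolding join_def by (auto dest!: B_stage_bounds[OF assms(1)])
  then have "{v. v < Suc N \<and> ?J (fst (prod_decode ?c)) v} = {v. ?J (fst (prod_decode ?c)) v}"
    by blast
  then show ?thesis
    unfolding Suc B_stage_Suc[OF assms(1)] by (simp add: B_step_def)
qed (simp add: B_step_def)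

text \<open>For arguments up to \<open>N\<close>, a step reads the preceding stage only at arguments
  up to \<open>N\<close>, because the entries of the new pair are also at most \<open>N\<close>. So
  a finite table suffices.\<close>

lemma B_step_cong:
  assumes "\<And>r u v. r < s \<Longrightarrow> u \<le> N \<Longrightarrow> v \<le> N \<Longrightarrow> M r u v = M' r u v" "s \<le> N" "x \<le> N" "y \<le> N"
  shows "B_step k e N M s x y = B_step k e N M' s x y"
proof (cases s)
  case (Suc r)
  let ?c = "fst (prod_decode r)"
  have *: "fst (prod_decode ?c) \<le> N" "snd (prod_decode ?c) \<le> N"
    using fst_prod_decode_le[of r] fst_prod_decode_le[of ?c] snd_prod_decode_le[of ?c] assms(2) Suc
    by linarith+
  have "join (fst (prod_decode ?c)) (snd (prod_decode ?c)) (M r) u v =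
      join (fst (prod_decode ?c)) (snd (prod_decode ?c)) (M' r) u v" if "u \<le> N" "v \<le> N" for u v
    using that * assms(1) Suc by (simp add: join_def)
  then have "join (fst (prod_decode ?c)) (snd (prod_decode ?c)) (M r) x y =
      join (fst (prod_decode ?c)) (snd (prod_decode ?c)) (M' r) x y"
    "{v. v < Suc N \<and> join (fst (prod_decode ?c)) (snd (prod_decode ?c)) (M r)
      (fst (prod_decode ?c)) v} =
     {v. v < Suc N \<and> join (fst (prod_decode ?c)) (snd (prod_decode ?c)) (M' r)
      (fst (prod_decode ?c)) v}"
    using * assms(3,4) by auto
  then show ?thesis using assms Suc by (simp add: B_step_def)
qed (simp add: B_step_def)

lemma B_step_unique:
  assumes "0 < k" "s \<le> N" "x \<le> N" "y \<le> N"
    and M: "\<And>r x y. r \<le> s \<Longrightarrow> x \<le> N \<Longrightarrow> y \<le> N \<Longrightarrow> M r x y \<longleftrightarrow> B_step k e N M r x y"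
  shows "M s x y \<longleftrightarrow> (x, y) \<in> B_stage k e s"
proof -
  have "M r x y \<longleftrightarrow> (x, y) \<in> B_stage k e r" if "r \<le> s" "x \<le> N" "y \<le> N" for r x y
    using that
  proof (induction r arbitrary: x y rule: less_induct)
    case (less r)
    have "M r x y \<longleftrightarrow> B_step k e N M r x y" using less M by blast
    also have "\<dots> \<longleftrightarrow> B_step k e N (\<lambda>s x y. (x, y) \<in> B_stage k e s) r x y"
      using less assms(2) by (intro B_step_cong) auto
    also have "\<dots> \<longleftrightarrow> (x, y) \<in> B_stage k e r"
      using B_stage_step[OF assms(1), of r N] less(2) assms(2) by simp
    finally show ?case .
  qed
  then show ?thesis using assms by blast
qed

definition B_table :: "nat \<Rightarrow> nat \<Rightarrow> nat \<Rightarrow> nat \<Rightarrow> bool" where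
  "B_table T s x y \<longleftrightarrow> prod_encode (s, prod_encode (x, y)) \<in> set_decode T"

lemma B_table_exists:
  assumes "0 < k" "s \<le> N"
  shows "\<exists>T. \<forall>r\<le>s. \<forall>x\<le>N. \<forall>y\<le>N. B_table T r x y \<longleftrightarrow> B_step k e N (B_table T) r x y"
proof -
  let ?P = "\<lambda>r x y. r \<le> s \<and> x \<le> N \<and> y \<le> N \<and> (x, y) \<in> B_stage k e r"
  let ?A = "{prod_encode (r, prod_encode (x, y)) | r x y. ?P r x y}"
  have "?A \<subseteq> (\<lambda>(r, x, y). prod_encode (r, prod_encode (x, y))) ` ({..s} \<times> {..N} \<times> {..N})"
  proof safe
    fix r x y assume "r \<le> s" "x \<le> N" "y \<le> N"
    then have "(r, x, y) \<in> {..s} \<times> {..N} \<times> {..N}" by simp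
    from imageI[OF this, of "\<lambda>(r, x, y). prod_encode (r, prod_encode (x, y))"]
    show "prod_encode (r, prod_encode (x, y)) \<in>
        (\<lambda>(r, x, y). prod_encode (r, prod_encode (x, y))) ` ({..s} \<times> {..N} \<times> {..N})"
      by (simp only: prod.case)
  qed
  then have fin: "finite ?A" by (rule finite_subset) simp
  obtain T where T: "set_decode T = ?A" using finite_set_code[OF fin] by blast
  have eq: "B_table T r x y \<longleftrightarrow> (x, y) \<in> B_stage k e r" if "r \<le> s" "x \<le> N" "y \<le> N" for r x y
    using that unfolding B_table_def T by simp
  have "B_table T r x y \<longleftrightarrow> B_step k e N (B_table T) r x y" if "r \<le> s" "x \<le> N" "y \<le> N" for r x y
  proof -
    have "B_step k e N (B_table T) r x y \<longleftrightarrow> B_step k e N (\<lambda>s x y. (x, y) \<in> B_stage k e s) r x y"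
      using that eq assms(2) by (intro B_step_cong) simp_all
    then show ?thesis using eq[OF that] B_stage_step[OF assms(1), of r N x y e] that(1) assms(2) by simp
  qed
  then show ?thesis by blast
qed

lemma decidable_B_stage [computable_intros]:
  assumes "0 < k" "computable e" "computable s" "computable x" "computable y"
  shows "decidable (\<lambda>z. (x z, y z) \<in> B_stage k (e z) (s z))"
proof -
  let ?C = "\<lambda>e s N T. \<forall>r\<le>s. \<forall>x\<le>N. \<forall>y\<le>N. B_table T r x y \<longleftrightarrow> B_step k e N (B_table T) r x y"
  let ?e = "\<lambda>z. fst (prod_decode z)" and ?s = "\<lambda>z. fst (prod_decode (snd (prod_decode z)))"
  let ?x = "\<lambda>z. fst (prod_decode (snd (prod_decode (snd (prod_decode z)))))"
  let ?y = "\<lambda>z. snd (prod_decode (snd (prod_decode (snd (prod_decode z)))))"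
  \<comment> \<open>This bound dominates the stage number and both arguments, as
    \<open>B_step_unique\<close> requires.\<close>
  let ?N = "\<lambda>z. ?s z + ?x z + ?y z"
  have "decidable (\<lambda>z. (?x z, ?y z) \<in> B_stage k (?e z) (?s z))"
  proof (rule decidable_certificate)
    show "decidable (\<lambda>z. (\<lambda>z T. ?C (?e z) (?s z) (?N z) T) (fst (prod_decode z)) (snd (prod_decode z)))"
      unfolding B_table_def B_step_def join_def by (intro computable_intros)
    show "decidable (\<lambda>z. (\<lambda>z T. B_table T (?s z) (?x z) (?y z))
        (fst (prod_decode z)) (snd (prod_decode z)))"
      unfolding B_table_def by (intro computable_intros)
    show "\<exists>T. ?C (?e z) (?s z) (?N z) T" for z by (rule B_table_exists) (simp_all add: assms(1))
    show "B_table T (?s z) (?x z) (?y z) \<longleftrightarrow> (?x z, ?y z) \<in> B_stage k (?e z) (?s z)"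
      if "?C (?e z) (?s z) (?N z) T" for z T
    proof (rule B_step_unique)
      show "B_table T r x y \<longleftrightarrow> B_step k (?e z) (?N z) (B_table T) r x y"
        if "r \<le> ?s z" "x \<le> ?N z" "y \<le> ?N z" for r x y
        using that \<open>?C (?e z) (?s z) (?N z) T\<close> by blast
    qed (simp_all add: assms(1))
  qed
  from decidable_comp[OF this, of "\<lambda>z. prod_encode (e z, prod_encode (s z, prod_encode (x z, y z)))"]
  show ?thesis using assms by (simp add: computable_intros)
qed

section \<open>Computably enumerable relations\<close>

lemma ce_rel_iff: "ce_rel R \<longleftrightarrow> (\<exists>e. \<forall>x y. (x, y) \<in> R \<longleftrightarrow> (\<exists>t. prod_encode (x, y) \<in> W_at e t))"
proof -
  have "prod_encode ` R = W e \<longleftrightarrow>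
      (\<forall>x y. (x, y) \<in> R \<longleftrightarrow> (\<exists>t. prod_encode (x, y) \<in> W_at e t))" for e
  proof -
    have "(prod_encode ` R = W e) \<longleftrightarrow> (\<forall>p. prod_encode p \<in> prod_encode ` R \<longleftrightarrow> prod_encode p \<in> W e)"
      by (metis prod_decode_inverse subsetI subset_antisym)
    also have "\<dots> \<longleftrightarrow> (\<forall>p. p \<in> R \<longleftrightarrow> prod_encode p \<in> W e)"
      by (simp add: inj_image_mem_iff[OF inj_prod_encode])
    finally show ?thesis by (simp add: W_eq_Union_W_at)
  qed
  then show ?thesis unfolding ce_rel_def by simp
qed

text \<open>The program searching for the least \<open>s\<close> halts exactly on the codes of
  related pairs, so its domain is the required c.e. set.\<close>

lemma ce_relI:
  assumes "decidable (\<lambda>z. Q (fst (prod_decode z)) (snd (prod_decode z)))"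
    and "\<And>x y. (x, y) \<in> R \<longleftrightarrow> (\<exists>s. Q (prod_encode (x, y)) s)"
  shows "ce_rel R"
proof -
  obtain p where p: "\<And>x. eval p x = (if \<exists>k. Q x k then Some (LEAST k. Q x k) else None)"
    using computable_Least_partial[OF assms(1)] by blast
  have "prod_encode ` R = W (encode_prog p)"
  proof (rule set_eqI)
    fix c
    have "c \<in> W (encode_prog p) \<longleftrightarrow> (\<exists>s. Q c s)"
      by (simp add: W_def phi_def decode_encode_prog dom_def p)
    then show "c \<in> prod_encode ` R \<longleftrightarrow> c \<in> W (encode_prog p)"
      using assms(2)[of "fst (prod_decode c)" "snd (prod_decode c)"]
        inj_image_mem_iff[OF inj_prod_encode, of "prod_decode c" R] by simp
  qed
  then show ?thesis unfolding ce_rel_def by blast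
qed

subsection \<open>The universal bounded ceers\<close>

lemma B_stage_le_B: "B_stage k e s \<subseteq> B k e"
  by (auto simp: B_def)

lemma equiv_B: "equiv UNIV (B k e)"
proof (intro equivI)
  have eq: "refl (B_stage k e s)" "sym (B_stage k e s)" "trans (B_stage k e s)" for s
    using equiv_B_stage[of k e s] by (simp_all add: equiv_def)
  show "refl (B k e)"
    using eq(1) unfolding B_def refl_on_def by blast
  show "sym (B k e)"
    using eq(2) unfolding B_def sym_def by blast
  show "trans (B k e)"
  proof (rule transI)
    fix x y z assume "(x, y) \<in> B k e" "(y, z) \<in> B k e"
    then obtain s t where "(x, y) \<in> B_stage k e s" "(y, z) \<in> B_stage k e t" by (auto simp: B_def)
    then have "(x, y) \<in> B_stage k e (max s t)" "(y, z) \<in> B_stage k e (max s t)"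
      using B_stage_mono[of s "max s t" k e] B_stage_mono[of t "max s t" k e] by auto
    then have "(x, z) \<in> B_stage k e (max s t)" using eq(3) by (blast dest: transD)
    then show "(x, z) \<in> B k e" using B_stage_le_B by blast
  qed
qed simp

text \<open>Compactness: an infinite or too large class has \<open>k + 1\<close> elements related to
  \<open>x\<close>, and all of them are related to \<open>x\<close> at a single stage
  already.\<close>

lemma bounded_classes_B:
  assumes "0 < k"
  shows "bounded_classes k (B k e)"
  unfolding bounded_classes_iff
proof (rule allI, rule ccontr)
  fix x assume "\<not> (finite (B k e `` {x}) \<and> card (B k e `` {x}) \<le> k)"
  then obtain F where F: "F \<subseteq> B k e `` {x}" "finite F" "card F = Suc k"
    by (metis infinite_arbitrarily_large not_less_eq_eq obtain_subset_with_card_n)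
  have "\<forall>y\<in>F. \<forall>\<^sub>F s in sequentially. (x, y) \<in> B_stage k e s"
  proof
    fix y assume "y \<in> F"
    then obtain s where "(x, y) \<in> B_stage k e s" using F(1) by (auto simp: B_def)
    then show "\<forall>\<^sub>F s in sequentially. (x, y) \<in> B_stage k e s"
      using B_stage_mono unfolding eventually_sequentially by blast
  qed
  then have "\<forall>\<^sub>F s in sequentially. \<forall>y\<in>F. (x, y) \<in> B_stage k e s"
    using F(2) by (simp add: eventually_ball_finite)
  then obtain s where "F \<subseteq> B_stage k e s `` {x}" by (auto simp: eventually_sequentially)
  moreover have "finite (B_stage k e s `` {x})" "card (B_stage k e s `` {x}) \<le> k"
    using bounded_B_stage[OF assms, of e s] by (simp_all add: bounded_classes_iff)
  ultimately show False using card_mono[of "B_stage k e s `` {x}" F] F(3) by simp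
qed

lemma mem_B_inf:
  "(prod_encode (x, z), prod_encode (y, w)) \<in> B_inf k \<longleftrightarrow> z = w \<and> (x, y) \<in> B k z"
  by (auto simp: B_inf_def)

lemma mem_B_inf_decode:
  "(u, v) \<in> B_inf k \<longleftrightarrow> snd (prod_decode u) = snd (prod_decode v) \<and>
    (fst (prod_decode u), fst (prod_decode v)) \<in> B k (snd (prod_decode u))"
  using mem_B_inf[of "fst (prod_decode u)" "snd (prod_decode u)" "fst (prod_decode v)"
      "snd (prod_decode v)"] by simp

text \<open>Each class lies in a copy of a class of a single \<open>B k z\<close>, and the stages
  are decidable uniformly in \<open>z\<close>, so a search over stages enumerates the
  relation.\<close>

lemma bounded_ceer_B_inf:
  assumes "0 < k"
  shows "bounded_ceer k (B_inf k)"
proof -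
  have eq: "refl (B k e)" "sym (B k e)" "trans (B k e)" for e
    using equiv_B[of k e] by (simp_all add: equiv_def)
  have "equiv UNIV (B_inf k)"
  proof (intro equivI)
    show "refl (B_inf k)"
      using eq(1) unfolding refl_on_def mem_B_inf_decode by simp
    show "sym (B_inf k)"
      using eq(2) unfolding sym_def mem_B_inf_decode by metis
    show "trans (B_inf k)"
      using eq(3) unfolding trans_def mem_B_inf_decode by metis
  qed simp
  moreover have "ce_rel (B_inf k)"
  proof (rule ce_relI)
    let ?Q = "\<lambda>c s. snd (prod_decode (fst (prod_decode c))) = snd (prod_decode (snd (prod_decode c))) \<and>
      (fst (prod_decode (fst (prod_decode c))), fst (prod_decode (snd (prod_decode c)))) \<in>
        B_stage k (snd (prod_decode (fst (prod_decode c)))) s"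
    show "decidable (\<lambda>z. ?Q (fst (prod_decode z)) (snd (prod_decode z)))"
      by (intro computable_intros assms)
    show "(u, v) \<in> B_inf k \<longleftrightarrow> (\<exists>s. ?Q (prod_encode (u, v)) s)" for u v
      by (simp add: mem_B_inf_decode B_def)
  qed
  moreover have "bounded_classes k (B_inf k)"
    unfolding bounded_classes_iff
  proof
    fix u
    let ?z = "snd (prod_decode u)"
    have sub: "B_inf k `` {u} \<subseteq> (\<lambda>y. prod_encode (y, ?z)) ` (B k ?z `` {fst (prod_decode u)})"
    proof
      fix v assume "v \<in> B_inf k `` {u}"
      then have "(u, v) \<in> B_inf k" by simp
      then have z: "?z = snd (prod_decode v)"
        and y: "fst (prod_decode v) \<in> B k ?z `` {fst (prod_decode u)}"
        unfolding mem_B_inf_decode by blast+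
      from z have "v = prod_encode (fst (prod_decode v), ?z)"
        by (metis prod.collapse prod_decode_inverse)
      from this y show "v \<in> (\<lambda>y. prod_encode (y, ?z)) ` (B k ?z `` {fst (prod_decode u)})" by (rule image_eqI)
    qed
    have fin: "finite (B k ?z `` {fst (prod_decode u)})"
      and card: "card (B k ?z `` {fst (prod_decode u)}) \<le> k"
      using bounded_classes_B[OF assms] by (simp_all add: bounded_classes_iff)
    show "finite (B_inf k `` {u}) \<and> card (B_inf k `` {u}) \<le> k"
      using finite_subset[OF sub finite_imageI[OF fin]] order_trans[OF surj_card_le[OF fin sub] card]
      by blast
  qed
  ultimately show ?thesis using assms by (simp add: bounded_ceer_def ceer_def)
qed

text \<open>Take for \<open>e\<close> an index of \<open>S\<close> itself. All enumerated pairs and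
  all merges remain inside \<open>S\<close>, whose classes are bounded, so no pair is ever
  omitted.\<close>

lemma B_eq_bounded_ceer:
  assumes "bounded_ceer k S"
  obtains e where "B k e = S"
proof -
  have S: "equiv UNIV S" "bounded_classes k S" "ce_rel S"
    using assms by (auto simp: bounded_ceer_def ceer_def)
  obtain e where e: "\<And>x y. (x, y) \<in> S \<longleftrightarrow> (\<exists>t. prod_encode (x, y) \<in> W_at e t)"
    using S(3) unfolding ce_rel_iff by blast
  have "p \<in> S" if "p \<in> prod_decode ` W_at e t" for p t
    using that e[of "fst p" "snd p"] by auto
  then have G: "generated_equiv (prod_decode ` W_at e t) \<subseteq> S" for t
    using generated_equiv_least[OF S(1)] by blast
  have le: "B_stage k e s \<subseteq> S" for s
  proof (induction s)
    case 0
    then show ?case using S(1) by (auto elim!: equivE dest: refl_onD)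
  next
    case (Suc s)
    have "generated_equiv (insert p (B_stage k e s)) \<subseteq> S"
      if "p \<in> generated_equiv (prod_decode ` W_at e t)" for p t
      using that Suc G by (intro generated_equiv_least[OF S(1)]) blast
    with Suc show ?case by (simp add: add_pair_def Let_def split: prod.split)
  qed
  have "S \<subseteq> B k e"
  proof
    fix p assume p: "p \<in> S"
    then obtain t where t: "prod_encode p \<in> W_at e t" using e[of "fst p" "snd p"] by auto
    \<comment> \<open>The stage that offers \<open>p\<close> together with a \<open>t\<close>
      witnessing its membership; \<open>p\<close> is present from stage \<open>Suc s\<close>
      on.\<close>
    define s where "s = prod_encode (prod_encode p, t)"
    have "p \<in> prod_decode ` W_at e t" using t by force
    then have "p \<in> generated_equiv (prod_decode ` W_at e t)"
      by (metis generated_equiv_mem prod.collapse)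
    then have "B_stage k e (Suc s) = add_pair k p (B_stage k e s)" by (simp add: s_def)
    moreover have "generated_equiv (insert p (B_stage k e s)) \<subseteq> S"
      using p le by (intro generated_equiv_least[OF S(1)]) simp
    then have "add_pair k p (B_stage k e s) = generated_equiv (insert p (B_stage k e s))"
      using bounded_classes_subset[OF S(2)] by (simp add: add_pair_def)
    moreover have "p \<in> generated_equiv (insert p (B_stage k e s))"
      by (metis generated_equiv_mem insertI1 prod.collapse)
    ultimately show "p \<in> B k e" using B_stage_le_B by blast
  qed
  then have "B k e = S" using le by (auto simp: B_def)
  then show ?thesis by (rule that)
qed

lemma bounded_ceer_le_B_inf:
  assumes "bounded_ceer k S"
  shows "S \<le>\<^sub>c B_inf k"
proof -
  obtain e where "B k e = S" using B_eq_bounded_ceer[OF assms] .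
  then have "(x, y) \<in> S \<longleftrightarrow> (prod_encode (x, e), prod_encode (y, e)) \<in> B_inf k" for x y
    by (simp add: mem_B_inf)
  moreover have "computable (\<lambda>x. prod_encode (x, e))" by (intro computable_intros)
  ultimately show ?thesis unfolding reducible_def by blast
qed

subsection \<open>Reductions to halting jumps\<close>

text \<open>Evaluation recovers the constant. Injectivity keeps the indices assigned to different
  inputs apart, which the diagonal clause of the jump requires.\<close>

lemma inj_const_prog: "inj const_prog"
proof (rule injI)
  fix x y assume "const_prog x = const_prog y"
  then have "eval (const_prog x) 0 = eval (const_prog y) 0" by (rule arg_cong)
  then show "x = y" by simp
qed

lemma computable_const_index: "computable (\<lambda>x. encode_prog (CompP p (const_prog x)))"
proof -
  \<comment> \<open>If \<open>r\<close> is the number of a program \<open>q\<close>, then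
    \<open>5 + 4 * prod_encode (1, r)\<close> is the number of \<open>CompP Succ q\<close>.\<close>
  have "encode_prog (const_prog x) = rec_nat 0 (\<lambda>k r. 5 + 4 * prod_encode (1, r)) x" for x
    by (induction x) simp_all
  moreover have "computable (\<lambda>x. 5 + 4 * prod_encode (encode_prog p,
      rec_nat 0 (\<lambda>k r. 5 + 4 * prod_encode (1, r)) x))"
    by (intro computable_rec_nat computable_intros)
  ultimately show ?thesis by simp
qed

text \<open>The index assigned to \<open>x\<close> belongs to a program that ignores its input and
  runs \<open>p\<close> on \<open>x\<close>, so on its own index it computes
  \<open>eval p x\<close>. Where \<open>p\<close> diverges, injectivity leaves only the diagonal of
  the jump, and by \<open>dom\<close> the class of \<open>x\<close> is trivial.\<close>

lemma reducible_halting_jumpI: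
  assumes R: "equiv UNIV R"
    and dom: "\<And>x y. (x, y) \<in> R \<Longrightarrow> x \<noteq> y \<Longrightarrow> \<exists>u. eval p x = Some u"
    and iff: "\<And>x y u v. eval p x = Some u \<Longrightarrow> eval p y = Some v \<Longrightarrow> (x, y) \<in> R \<longleftrightarrow> (u, v) \<in> T"
  shows "R \<le>\<^sub>c halting_jump T"
proof -
  let ?f = "\<lambda>x. encode_prog (CompP p (const_prog x))"
  have "phi (?f x) z = eval p x" for x z
    by (simp add: phi_def decode_encode_prog pf_comp_def del: encode_prog.simps)
  moreover have "?f x = ?f y \<longleftrightarrow> x = y" for x y
    by (metis decode_encode_prog prog.inject(2) inj_const_prog injD)
  ultimately have jump: "(?f x, ?f y) \<in> halting_jump T \<longleftrightarrow>
      x = y \<or> (\<exists>u v. eval p x = Some u \<and> eval p y = Some v \<and> (u, v) \<in> T)" for x y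
    by (simp add: halting_jump_def del: encode_prog.simps)
  have "(x, y) \<in> R \<longleftrightarrow> (?f x, ?f y) \<in> halting_jump T" for x y
  proof (cases "x = y")
    case True
    moreover have "(x, x) \<in> R" using R by (auto simp: equiv_def dest: refl_onD)
    ultimately show ?thesis by (simp add: jump del: encode_prog.simps)
  next
    case False
    \<comment> \<open>\<open>dom\<close> gives convergence only at the first element of a pair;
      symmetry supplies it at the second.\<close>
    have "(y, x) \<in> R" if "(x, y) \<in> R" using that R by (auto simp: equiv_def dest: symD)
    then show ?thesis using False dom iff unfolding jump by metis
  qed
  then show ?thesis using computable_const_index unfolding reducible_def by blast
qed

subsection \<open>Halving the size of classes\<close>

text \<open>
  The selected edges are disjoint, and the first edge inside a nontrivial class is selected. So
  the first ends of the selected edges meet every nontrivial class, and make up at most half of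
  it because the second ends are different elements of the same class.
\<close>

definition fst_end :: "nat \<Rightarrow> nat" where
  "fst_end s = fst (prod_decode (fst (prod_decode s)))"

definition snd_end :: "nat \<Rightarrow> nat" where
  "snd_end s = snd (prod_decode (fst (prod_decode s)))"

text \<open>The number \<open>s\<close> codes a pair together with a stage, which orders the edges
  linearly and makes being an edge decidable.\<close>

definition edge :: "nat \<Rightarrow> nat \<Rightarrow> bool" where
  "edge e s \<longleftrightarrow> fst (prod_decode s) \<in> W_at e (snd (prod_decode s)) \<and> fst_end s \<noteq> snd_end s"

text \<open>The comparison is with all earlier edges, not only with selected ones, so no recursion
  is involved. A repetition of an earlier edge is never selected.\<close>

definition selected :: "nat \<Rightarrow> nat \<Rightarrow> bool" where
  "selected e s \<longleftrightarrow> edge e s \<and> (\<forall>r<s. edge e r \<longrightarrow>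
     fst_end r \<noteq> fst_end s \<and> fst_end r \<noteq> snd_end s \<and>
     snd_end r \<noteq> fst_end s \<and> snd_end r \<noteq> snd_end s)"

lemma decidable_selected [computable_intros]:
  assumes "computable s"
  shows "decidable (\<lambda>z. selected e (s z))"
  unfolding selected_def edge_def fst_end_def snd_end_def
  by (intro computable_intros assms computable_comp[OF assms])

lemma selected_disjoint:
  assumes "selected e r" "selected e s"
    and "fst_end r = fst_end s \<or> fst_end r = snd_end s \<or> snd_end r = fst_end s \<or> snd_end r = snd_end s"
  shows "r = s"
  using assms by (metis linorder_neqE_nat selected_def)

text \<open>\<open>T\<close> stays arbitrary so that the same construction serves both claims, with
  \<open>T\<close> either \<open>S\<close> itself or the universal ceer.\<close>

lemma halting_jump_lowers_bound:
  assumes n: "n \<ge> 2" and "bounded_ceer n R"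
  obtains S where "bounded_ceer (n div 2) S" "\<And>T. S \<le>\<^sub>c T \<Longrightarrow> R \<le>\<^sub>c halting_jump T"
proof -
  have eqR: "equiv UNIV R" and "ce_rel R" and bd: "bounded_classes n R"
    using assms(2) by (auto simp: bounded_ceer_def ceer_def)
  obtain e where e: "\<And>x y. (x, y) \<in> R \<longleftrightarrow> (\<exists>t. prod_encode (x, y) \<in> W_at e t)"
    using \<open>ce_rel R\<close> unfolding ce_rel_iff by blast
  have refl: "(x, x) \<in> R" and sym: "(x, y) \<in> R \<Longrightarrow> (y, x) \<in> R"
    and trans: "(x, y) \<in> R \<Longrightarrow> (y, z) \<in> R \<Longrightarrow> (x, z) \<in> R" for x y z
    using eqR unfolding equiv_def by (auto simp: refl_on_def dest: symD transD)
  have edge: "(fst_end s, snd_end s) \<in> R \<and> fst_end s \<noteq> snd_end s" if "edge e s" for s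
    using that e[of "fst_end s" "snd_end s"] by (auto simp: edge_def fst_end_def snd_end_def)
  have ex: "\<exists>s. selected e s \<and> (x, fst_end s) \<in> R" if "(x, y) \<in> R" "x \<noteq> y" for x y
  proof -
    let ?P = "\<lambda>s. edge e s \<and> (x, fst_end s) \<in> R"
    obtain t where "prod_encode (x, y) \<in> W_at e t" using e \<open>(x, y) \<in> R\<close> by blast
    then have P: "?P (prod_encode (prod_encode (x, y), t))"
      using \<open>x \<noteq> y\<close> refl by (simp add: edge_def fst_end_def snd_end_def)
    \<comment> \<open>The first edge in the class of \<open>x\<close>. An earlier edge meeting it
      would lie in the same class, against minimality, so this edge is selected.\<close>
    define s where "s = (LEAST s. ?P s)"
    have s: "?P s" unfolding s_def by (rule LeastI) (rule P)
    have least: "\<not> ?P r" if "r < s" for r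
      using not_less_Least[of r ?P] that unfolding s_def by blast
    have "fst_end r \<noteq> fst_end s \<and> fst_end r \<noteq> snd_end s \<and>
        snd_end r \<noteq> fst_end s \<and> snd_end r \<noteq> snd_end s" if "r < s" "edge e r" for r
      using least[OF that(1)] that(2) s edge[of r] edge[of s] sym trans by metis
    with s show ?thesis unfolding selected_def by blast
  qed
  define A where "A = fst_end ` {s. selected e s}"
  define S where "S = {(u, v). u = v \<or> (u, v) \<in> R \<and> u \<in> A \<and> v \<in> A}"
  have "equiv UNIV S"
  proof (intro equivI)
    show "refl S" by (simp add: S_def refl_on_def)
    show "sym S" unfolding S_def sym_def using sym by blast
    show "trans S" unfolding S_def trans_def using trans by blast
  qed simp
  moreover have "ce_rel S"
  proof (rule ce_relI)
    \<comment> \<open>Off the diagonal, \<open>w\<close> codes a stage showing the two elements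
      equivalent, followed by two selected edges having them as first ends.\<close>
    let ?Q = "\<lambda>c w. fst (prod_decode c) = snd (prod_decode c) \<or>
      c \<in> W_at e (fst (prod_decode w)) \<and>
      selected e (fst (prod_decode (snd (prod_decode w)))) \<and>
      selected e (snd (prod_decode (snd (prod_decode w)))) \<and>
      fst_end (fst (prod_decode (snd (prod_decode w)))) = fst (prod_decode c) \<and>
      fst_end (snd (prod_decode (snd (prod_decode w)))) = snd (prod_decode c)"
    show "decidable (\<lambda>z. ?Q (fst (prod_decode z)) (snd (prod_decode z)))"
      unfolding fst_end_def by (intro computable_intros)
    show "(u, v) \<in> S \<longleftrightarrow> (\<exists>w. ?Q (prod_encode (u, v)) w)" for u v
    proof
      assume "(u, v) \<in> S"
      then consider "u = v" | t r s where "prod_encode (u, v) \<in> W_at e t" "selected e r"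
        "selected e s" "fst_end r = u" "fst_end s = v"
        unfolding S_def A_def using e by auto
      then show "\<exists>w. ?Q (prod_encode (u, v)) w"
      proof cases
        case 2
        then have "?Q (prod_encode (u, v)) (prod_encode (t, prod_encode (r, s)))" by simp
        then show ?thesis by blast
      qed simp
    next
      show "\<exists>w. ?Q (prod_encode (u, v)) w \<Longrightarrow> (u, v) \<in> S"
        unfolding S_def A_def using e by auto
    qed
  qed
  moreover have "bounded_classes (n div 2) S"
    unfolding bounded_classes_iff
  proof
    fix u
    show "finite (S `` {u}) \<and> card (S `` {u}) \<le> n div 2"
    proof (cases "u \<in> A")
      case False
      then have "S `` {u} = {u}" by (auto simp: S_def)
      \<comment> \<open>Here \<open>n \<ge> 2\<close> ensures that a one-element class respects the
        bound.\<close>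
      then show ?thesis using n by simp
    next
      case True
      let ?D = "R `` {u} \<inter> A"
      have S: "S `` {u} = ?D" using True refl by (auto simp: S_def)
      have fin: "finite (R `` {u})" "card (R `` {u}) \<le> n" using bd by (simp_all add: bounded_classes_iff)
      have "\<forall>v\<in>A. \<exists>s. selected e s \<and> fst_end s = v" by (auto simp: A_def)
      then obtain \<sigma> where \<sigma>: "\<And>v. v \<in> A \<Longrightarrow> selected e (\<sigma> v) \<and> fst_end (\<sigma> v) = v" by metis
      \<comment> \<open>The partner of \<open>v\<close> in its edge. Partners of different elements
        differ, lie in the class of \<open>u\<close> and avoid \<open>A\<close>, so this class has
        at least twice as many elements as \<open>?D\<close>.\<close>
      let ?p = "\<lambda>v. snd_end (\<sigma> v)"
      have inj: "inj_on ?p ?D"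
        using \<sigma> selected_disjoint by (intro inj_onI) (metis IntD2)
      have "?p ` ?D \<subseteq> R `` {u}"
        using \<sigma> edge trans unfolding selected_def by fastforce
      moreover have "?p ` ?D \<inter> ?D = {}"
      proof -
        \<comment> \<open>A common value would make the two edges equal, and then the two ends of
          that one edge equal.\<close>
        have "?p v \<noteq> w" if "v \<in> A" "w \<in> A" for v w
          using \<sigma>[OF that(1)] \<sigma>[OF that(2)] selected_disjoint[of e "\<sigma> v" "\<sigma> w"]
            edge[of "\<sigma> v"] by (auto simp: selected_def)
        then show ?thesis by blast
      qed
      ultimately have "card (?p ` ?D) + card ?D \<le> card (R `` {u})"
        using fin(1) by (metis card_Un_disjoint card_mono finite_Int finite_imageI inf_le1 Un_least)
      then have "2 * card ?D \<le> n" using fin(2) by (simp add: card_image[OF inj])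
      then show ?thesis using fin(1) by (simp add: S)
    qed
  qed
  ultimately have "bounded_ceer (n div 2) S" using n by (simp add: bounded_ceer_def ceer_def)
  moreover have "R \<le>\<^sub>c halting_jump T" if "S \<le>\<^sub>c T" for T
  proof -
    obtain c where "computable c" and c: "\<And>u v. (u, v) \<in> S \<longleftrightarrow> (c u, c v) \<in> T"
      using \<open>S \<le>\<^sub>c T\<close> unfolding reducible_def by blast
    \<comment> \<open>Here \<open>w\<close> codes a selected edge and a stage at which
      \<open>x\<close> is seen equivalent to its first end. Below, \<open>p\<close> finds such a
      \<open>w\<close>, and \<open>q\<close> turns it into the image of that end under the reduction
      \<open>c\<close>.\<close>
    let ?P = "\<lambda>x w. selected e (fst (prod_decode w)) \<and>
      prod_encode (x, fst_end (fst (prod_decode w))) \<in> W_at e (snd (prod_decode w))"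
    have "decidable (\<lambda>z. ?P (fst (prod_decode z)) (snd (prod_decode z)))"
      unfolding fst_end_def by (intro computable_intros)
    then obtain p where
      p: "\<And>x. eval p x = (if \<exists>w. ?P x w then Some (LEAST w. ?P x w) else None)"
      using computable_Least_partial[of ?P] by blast
    have "computable (\<lambda>w. c (fst_end (fst (prod_decode w))))"
      unfolding fst_end_def by (intro computable_intros computable_comp[OF \<open>computable c\<close>])
    then obtain q where q: "\<And>w. eval q w = Some (c (fst_end (fst (prod_decode w))))"
      unfolding computable_iff_eval by blast
    show ?thesis
    proof (rule reducible_halting_jumpI[OF eqR, of "CompP q p"])
      show "\<exists>u. eval (CompP q p) x = Some u" if xy: "(x, y) \<in> R" "x \<noteq> y" for x y
      proof -
        obtain s t where "selected e s" "prod_encode (x, fst_end s) \<in> W_at e t"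
          using ex[OF xy] e by blast
        then have "?P x (prod_encode (s, t))" by simp
        then have "\<exists>w. ?P x w" by (rule exI)
        then show ?thesis by (simp add: pf_comp_def p q)
      qed
      have reach: "\<exists>a\<in>A. (x, a) \<in> R \<and> u = c a" if "eval (CompP q p) x = Some u" for x u
      proof -
        have "\<exists>w. ?P x w" using that by (auto simp: pf_comp_def p split: if_splits)
        moreover define w where "w = (LEAST w. ?P x w)"
        ultimately have "?P x w" "u = c (fst_end (fst (prod_decode w)))"
          using that LeastI_ex[of "?P x"] by (auto simp: pf_comp_def p q)
        then show ?thesis using e unfolding A_def by blast
      qed
      show "(x, y) \<in> R \<longleftrightarrow> (u, v) \<in> T"
        if xy: "eval (CompP q p) x = Some u" "eval (CompP q p) y = Some v" for x y u v
      proof -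
        obtain a b where "a \<in> A" "(x, a) \<in> R" "u = c a" "b \<in> A" "(y, b) \<in> R" "v = c b"
          using reach[OF xy(1)] reach[OF xy(2)] by blast
        \<comment> \<open>Both representatives lie in \<open>A\<close>, where \<open>S\<close> and
          \<open>R\<close> agree, so \<open>c\<close> decides the equivalence of \<open>x\<close>
          and \<open>y\<close> through \<open>a\<close> and \<open>b\<close>.\<close>
        moreover from this have "(a, b) \<in> S \<longleftrightarrow> (a, b) \<in> R" using refl by (auto simp: S_def)
        ultimately show ?thesis using c sym trans by metis
      qed
    qed
  qed
  ultimately show ?thesis by (rule that)
qed

theorem theorem8p6:
  fixes n :: nat
  assumes "n \<ge> 2"
  shows "(\<forall>R. bounded_ceer n R \<longrightarrow>
            (\<exists>S. bounded_ceer (n div 2) S \<and> R \<le>\<^sub>c halting_jump S))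
       \<and> B_inf n \<le>\<^sub>c halting_jump (B_inf (n div 2))"
proof (intro conjI allI impI)
  fix R assume "bounded_ceer n R"
  then obtain S where "bounded_ceer (n div 2) S" "\<And>T. S \<le>\<^sub>c T \<Longrightarrow> R \<le>\<^sub>c halting_jump T"
    using halting_jump_lowers_bound[OF assms] by metis
  moreover have "S \<le>\<^sub>c S" unfolding reducible_def using computable_id by blast
  ultimately show "\<exists>S. bounded_ceer (n div 2) S \<and> R \<le>\<^sub>c halting_jump S" by blast
next
  have "bounded_ceer n (B_inf n)" using assms by (intro bounded_ceer_B_inf) simp
  then obtain S where "bounded_ceer (n div 2) S"
    "\<And>T. S \<le>\<^sub>c T \<Longrightarrow> B_inf n \<le>\<^sub>c halting_jump T"
    using halting_jump_lowers_bound[OF assms] by metis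
  then show "B_inf n \<le>\<^sub>c halting_jump (B_inf (n div 2))" using bounded_ceer_le_B_inf by blast
qed

end
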